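(* Let $\mathcal{E}$ be a locally free $\mathcal{O}$-module of finite rank and $\mathcal{G}$ an arbitrary coherent $\mathcal{O}$-module on $X$. Then for every $k>0$ the space of vertex operators for strings of $\mathrm{Ext}^k(\mathcal{E},\mathcal{G})$ is zero, that is, $$\bigoplus_q H^q\big(X,\mathcal{E}xt^k(\mathcal{E},\mathcal{G})\big)=0 .$$
   Context: $X$ is a compact Kähler manifold of dimension $n$, $\mathcal{O}$ is its sheaf of germs of holomorphic functions, and $\mathcal{E}xt^k(\mathcal{F},\mathcal{G})=H^kR\mathcal{H}om(\mathcal{F},\mathcal{G})$ denotes the sheaf Ext. For coherent sheaves $\mathcal{F},\mathcal{G}$, the space of vertex operators for strings with ghost number $k$ from $\mathcal{F}$ to $\mathcal{G}$ is defined as $\bigoplus_q H^q(X,\mathcal{E}xt^k(\mathcal{F},\mathcal{G}))$. *)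

theory Defs
  imports "HOL-Analysis.Analysis" "HOL-Algebra.Product_Groups" "HOL-Algebra.AbelCoset" "HOL-Algebra.Module"
begin

section \<open>Complex manifolds\<close>

text \<open>
  The space \<open>\<complex>\<^sup>n\<close> is modelled, like the library's \<^const>\<open>Euclidean_space\<close>, by
  sequences that vanish from index \<open>n\<close> on.  Thus \<open>n\<close> is an ordinary natural number, and
  \<open>n = 0\<close> is allowed.
\<close>

definition complex_space :: "nat \<Rightarrow> (nat \<Rightarrow> complex) topology" where
  "complex_space n = subtopology (product_topology (\<lambda>_. euclidean) UNIV) {z. \<forall>i\<ge>n. z i = 0}"

definition holomorphic_n :: "nat \<Rightarrow> (nat \<Rightarrow> complex) set \<Rightarrow> ((nat \<Rightarrow> complex) \<Rightarrow> complex) \<Rightarrow> bool" where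
  "holomorphic_n n U f \<longleftrightarrow>
     continuous_map (subtopology (complex_space n) U) euclidean f \<and>
     (\<forall>z\<in>U. \<forall>i<n. (\<lambda>w. f (z(i := w))) field_differentiable (at (z i)))"

text \<open>The real derivative of \<open>f\<close> at \<open>z\<close> along \<open>c\<close> in the \<open>i\<close>-th coordinate; \<open>c = 1\<close> and
  \<open>c = \<i>\<close> give \<open>\<partial>/\<partial>x\<^sub>i\<close> and \<open>\<partial>/\<partial>y\<^sub>i\<close>.\<close>

definition real_partial :: "nat \<Rightarrow> complex \<Rightarrow> ((nat \<Rightarrow> complex) \<Rightarrow> complex) \<Rightarrow> (nat \<Rightarrow> complex) \<Rightarrow> complex" where
  "real_partial i c f z = vector_derivative (\<lambda>t::real. f (z(i := z i + t *\<^sub>R c))) (at 0)"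

primrec continuously_differentiable ::
  "nat \<Rightarrow> nat \<Rightarrow> (nat \<Rightarrow> complex) set \<Rightarrow> ((nat \<Rightarrow> complex) \<Rightarrow> complex) \<Rightarrow> bool" where
  "continuously_differentiable n 0 U f \<longleftrightarrow>
     continuous_map (subtopology (complex_space n) U) euclidean f"
| "continuously_differentiable n (Suc m) U f \<longleftrightarrow>
     continuous_map (subtopology (complex_space n) U) euclidean f \<and>
     (\<forall>i<n. \<forall>c\<in>{1, \<i>}.
        (\<forall>z\<in>U. (\<lambda>t::real. f (z(i := z i + t *\<^sub>R c))) differentiable (at 0)) \<and>
        continuously_differentiable n m U (real_partial i c f))"

definition smooth_n :: "nat \<Rightarrow> (nat \<Rightarrow> complex) set \<Rightarrow> ((nat \<Rightarrow> complex) \<Rightarrow> complex) \<Rightarrow> bool" where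
  "smooth_n n U f \<longleftrightarrow> (\<forall>m. continuously_differentiable n m U f)"

text \<open>The Wirtinger operators \<open>\<partial>/\<partial>z\<^sub>i\<close> and \<open>\<partial>/\<partial>z\<^sub>i\<close>-bar.\<close>

definition wirtinger :: "nat \<Rightarrow> ((nat \<Rightarrow> complex) \<Rightarrow> complex) \<Rightarrow> (nat \<Rightarrow> complex) \<Rightarrow> complex" where
  "wirtinger i f z = (real_partial i 1 f z - \<i> * real_partial i \<i> f z) / 2"

definition wirtinger_bar :: "nat \<Rightarrow> ((nat \<Rightarrow> complex) \<Rightarrow> complex) \<Rightarrow> (nat \<Rightarrow> complex) \<Rightarrow> complex" where
  "wirtinger_bar i f z = (real_partial i 1 f z + \<i> * real_partial i \<i> f z) / 2"

type_synonym 'a chart = "'a set \<times> ('a \<Rightarrow> nat \<Rightarrow> complex)"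

definition is_chart :: "nat \<Rightarrow> 'a topology \<Rightarrow> 'a chart \<Rightarrow> bool" where
  "is_chart n X = (\<lambda>(U, \<phi>). openin X U \<and> openin (complex_space n) (\<phi> ` U) \<and>
     homeomorphic_map (subtopology X U) (subtopology (complex_space n) (\<phi> ` U)) \<phi>)"

definition transition :: "'a chart \<Rightarrow> 'a chart \<Rightarrow> (nat \<Rightarrow> complex) \<Rightarrow> (nat \<Rightarrow> complex)" where
  "transition = (\<lambda>(U, \<phi>) (V, \<psi>). \<psi> \<circ> inv_into U \<phi>)"

definition holomorphic_atlas :: "nat \<Rightarrow> 'a topology \<Rightarrow> 'a chart set \<Rightarrow> bool" where
  "holomorphic_atlas n X A \<longleftrightarrow>
     (\<forall>c\<in>A. is_chart n X c) \<and> (\<Union>c\<in>A. fst c) = topspace X \<and>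
     (\<forall>c\<in>A. \<forall>d\<in>A. \<forall>i<n.
        holomorphic_n n (snd c ` (fst c \<inter> fst d)) (\<lambda>z. transition c d z i))"

definition complex_manifold :: "nat \<Rightarrow> 'a topology \<Rightarrow> 'a chart set \<Rightarrow> bool" where
  "complex_manifold n X A \<longleftrightarrow>
     Hausdorff_space X \<and> second_countable X \<and> holomorphic_atlas n X A"

text \<open>
  A Hermitian metric is given by its coefficients \<open>h c i j\<close> in every chart \<open>c\<close>, that is
  \<open>h = \<Sum> h c i j dz\<^sub>i \<otimes> dz\<^sub>j\<close>-bar, related by the tensor transformation rule on overlaps.
\<close>

definition hermitian_metric ::
  "nat \<Rightarrow> 'a chart set \<Rightarrow> ('a chart \<Rightarrow> nat \<Rightarrow> nat \<Rightarrow> (nat \<Rightarrow> complex) \<Rightarrow> complex) \<Rightarrow> bool" where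
  "hermitian_metric n A h \<longleftrightarrow>
     (\<forall>c\<in>A. \<forall>i<n. \<forall>j<n. smooth_n n (snd c ` fst c) (h c i j)) \<and>
     (\<forall>c\<in>A. \<forall>z \<in> snd c ` fst c.
        (\<forall>i<n. \<forall>j<n. h c j i z = cnj (h c i j z)) \<and>
        (\<forall>v. (\<exists>i<n. v i \<noteq> 0) \<longrightarrow> Re (\<Sum>i<n. \<Sum>j<n. h c i j z * v i * cnj (v j)) > 0)) \<and>
     (\<forall>c\<in>A. \<forall>d\<in>A. \<forall>z \<in> snd c ` (fst c \<inter> fst d). \<forall>i<n. \<forall>j<n.
        h c i j z =
          (\<Sum>k<n. \<Sum>l<n. h d k l (transition c d z) *
             wirtinger i (\<lambda>w. transition c d w k) z *
             cnj (wirtinger j (\<lambda>w. transition c d w l) z)))"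

text \<open>
  The condition \<open>d\<omega> = 0\<close> for \<open>\<omega> = (\<i>/2) \<Sum> h c i j dz\<^sub>i \<and> dz\<^sub>j\<close>-bar, written out in
  coordinates: the two lines are the vanishing of the coefficients of the \<open>(2,1)\<close>-part
  \<open>dz\<^sub>k \<and> dz\<^sub>i \<and> dz\<^sub>j\<close>-bar and of the \<open>(1,2)\<close>-part of \<open>d\<omega>\<close>.
\<close>

definition closed_fundamental_form ::
  "nat \<Rightarrow> 'a chart set \<Rightarrow> ('a chart \<Rightarrow> nat \<Rightarrow> nat \<Rightarrow> (nat \<Rightarrow> complex) \<Rightarrow> complex) \<Rightarrow> bool" where
  "closed_fundamental_form n A h \<longleftrightarrow>
     (\<forall>c\<in>A. \<forall>z \<in> snd c ` fst c. \<forall>i<n. \<forall>j<n. \<forall>k<n.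
        wirtinger k (h c i j) z - wirtinger i (h c k j) z = 0 \<and>
        wirtinger_bar k (h c i j) z - wirtinger_bar j (h c i k) z = 0)"

definition compact_kaehler_manifold :: "nat \<Rightarrow> 'a topology \<Rightarrow> 'a chart set \<Rightarrow> bool" where
  "compact_kaehler_manifold n X A \<longleftrightarrow>
     complex_manifold n X A \<and> compact_space X \<and>
     (\<exists>h. hermitian_metric n A h \<and> closed_fundamental_form n A h)"


section \<open>The structure sheaf\<close>

text \<open>Sections over \<open>U\<close> are functions that are \<^const>\<open>undefined\<close> outside \<open>U\<close>; restriction of
  sections is \<^const>\<open>restrict\<close>.\<close>

definition structure_sheaf :: "nat \<Rightarrow> 'a chart set \<Rightarrow> 'a set \<Rightarrow> ('a \<Rightarrow> complex) ring" where
  "structure_sheaf n A U =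
     \<lparr>carrier = {f \<in> extensional U. \<forall>c\<in>A.
                   holomorphic_n n (snd c ` (U \<inter> fst c)) (f \<circ> inv_into (fst c) (snd c))},
      mult = (\<lambda>f g. \<lambda>x\<in>U. f x * g x), one = (\<lambda>x\<in>U. 1),
      zero = (\<lambda>x\<in>U. 0), add = (\<lambda>f g. \<lambda>x\<in>U. f x + g x)\<rparr>"


section \<open>Sheaves of modules\<close>

text \<open>
  Below, \<open>\<O>\<close> is a sheaf of rings of complex-valued functions.  The fields \<open>mult\<close> and \<open>one\<close>
  that the record of modules inherits from rings carry no meaning.  The restriction of a sheaf
  to an open set \<open>U\<close> is the same record, considered over \<open>subtopology X U\<close>.
\<close>

type_synonym 'a function_sheaf = "'a set \<Rightarrow> ('a \<Rightarrow> complex) ring"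

record ('a, 'm) mod_sheaf =
  sect :: "'a set \<Rightarrow> ('a \<Rightarrow> complex, 'm) module"
  restr :: "'a set \<Rightarrow> 'a set \<Rightarrow> 'm \<Rightarrow> 'm"

definition module_presheaf :: "'a topology \<Rightarrow> 'a function_sheaf \<Rightarrow> ('a, 'm) mod_sheaf \<Rightarrow> bool" where
  "module_presheaf X \<O> F \<longleftrightarrow>
     (\<forall>U. openin X U \<longrightarrow> module (\<O> U) (sect F U)) \<and>
     (\<forall>U V. openin X U \<and> openin X V \<and> V \<subseteq> U \<longrightarrow>
        restr F U V \<in> hom (add_monoid (sect F U)) (add_monoid (sect F V)) \<and>
        (\<forall>f\<in>carrier (\<O> U). \<forall>s\<in>carrier (sect F U).
           restr F U V (f \<odot>\<^bsub>sect F U\<^esub> s) = restrict f V \<odot>\<^bsub>sect F V\<^esub> restr F U V s)) \<and>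
     (\<forall>U. openin X U \<longrightarrow> (\<forall>s\<in>carrier (sect F U). restr F U U s = s)) \<and>
     (\<forall>U V W. openin X U \<and> openin X V \<and> openin X W \<and> W \<subseteq> V \<and> V \<subseteq> U \<longrightarrow>
        (\<forall>s\<in>carrier (sect F U). restr F V W (restr F U V s) = restr F U W s))"

definition module_sheaf :: "'a topology \<Rightarrow> 'a function_sheaf \<Rightarrow> ('a, 'm) mod_sheaf \<Rightarrow> bool" where
  "module_sheaf X \<O> F \<longleftrightarrow> module_presheaf X \<O> F \<and>
     (\<forall>\<U>. (\<forall>V\<in>\<U>. openin X V) \<longrightarrow>
        (\<forall>s\<in>carrier (sect F (\<Union>\<U>)). \<forall>t\<in>carrier (sect F (\<Union>\<U>)).
           (\<forall>V\<in>\<U>. restr F (\<Union>\<U>) V s = restr F (\<Union>\<U>) V t) \<longrightarrow> s = t) \<and>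
        (\<forall>s. (\<forall>V\<in>\<U>. s V \<in> carrier (sect F V)) \<and>
             (\<forall>V\<in>\<U>. \<forall>W\<in>\<U>. restr F V (V \<inter> W) (s V) = restr F W (V \<inter> W) (s W)) \<longrightarrow>
             (\<exists>t\<in>carrier (sect F (\<Union>\<U>)). \<forall>V\<in>\<U>. restr F (\<Union>\<U>) V t = s V)))"

text \<open>Morphisms are kept \<^const>\<open>undefined\<close> outside their domain, so that the zero morphism, and
  with it the group structure on morphisms, is unambiguous.\<close>

definition sheaf_hom ::
  "'a topology \<Rightarrow> 'a function_sheaf \<Rightarrow> ('a, 'm) mod_sheaf \<Rightarrow> ('a, 'k) mod_sheaf \<Rightarrow> ('a set \<Rightarrow> 'm \<Rightarrow> 'k) set" where
  "sheaf_hom X \<O> F G = {\<phi> \<in> extensional {U. openin X U}.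
     (\<forall>U. openin X U \<longrightarrow>
        \<phi> U \<in> extensional (carrier (sect F U)) \<and>
        \<phi> U \<in> hom (add_monoid (sect F U)) (add_monoid (sect G U)) \<and>
        (\<forall>f\<in>carrier (\<O> U). \<forall>s\<in>carrier (sect F U).
           \<phi> U (f \<odot>\<^bsub>sect F U\<^esub> s) = f \<odot>\<^bsub>sect G U\<^esub> \<phi> U s)) \<and>
     (\<forall>U V. openin X U \<and> openin X V \<and> V \<subseteq> U \<longrightarrow>
        (\<forall>s\<in>carrier (sect F U). \<phi> V (restr F U V s) = restr G U V (\<phi> U s)))}"

definition sheaf_mono :: "'a topology \<Rightarrow> ('a, 'm) mod_sheaf \<Rightarrow> ('a set \<Rightarrow> 'm \<Rightarrow> 'k) \<Rightarrow> bool" where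
  "sheaf_mono X F \<phi> \<longleftrightarrow> (\<forall>U. openin X U \<longrightarrow> inj_on (\<phi> U) (carrier (sect F U)))"

definition sheaf_iso ::
  "'a topology \<Rightarrow> ('a, 'm) mod_sheaf \<Rightarrow> ('a, 'k) mod_sheaf \<Rightarrow> ('a set \<Rightarrow> 'm \<Rightarrow> 'k) \<Rightarrow> bool" where
  "sheaf_iso X F G \<phi> \<longleftrightarrow>
     (\<forall>U. openin X U \<longrightarrow> bij_betw (\<phi> U) (carrier (sect F U)) (carrier (sect G U)))"

definition sheaf_kernel ::
  "('a, 'm) mod_sheaf \<Rightarrow> ('a, 'k) mod_sheaf \<Rightarrow> ('a set \<Rightarrow> 'm \<Rightarrow> 'k) \<Rightarrow> 'a set \<Rightarrow> 'm set" where
  "sheaf_kernel F G \<phi> U = {s \<in> carrier (sect F U). \<phi> U s = \<zero>\<^bsub>sect G U\<^esub>}"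

text \<open>The sections over \<open>U\<close> of the image sheaf: those that lift locally.\<close>

definition sheaf_image ::
  "'a topology \<Rightarrow> ('a, 'm) mod_sheaf \<Rightarrow> ('a, 'k) mod_sheaf \<Rightarrow> ('a set \<Rightarrow> 'm \<Rightarrow> 'k) \<Rightarrow> 'a set \<Rightarrow> 'k set" where
  "sheaf_image X F G \<phi> U = {s \<in> carrier (sect G U). \<forall>x\<in>U. \<exists>V. openin X V \<and> x \<in> V \<and> V \<subseteq> U \<and>
     (\<exists>t\<in>carrier (sect F V). \<phi> V t = restr G U V s)}"

definition sheaf_epi ::
  "'a topology \<Rightarrow> ('a, 'm) mod_sheaf \<Rightarrow> ('a, 'k) mod_sheaf \<Rightarrow> ('a set \<Rightarrow> 'm \<Rightarrow> 'k) \<Rightarrow> bool" where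
  "sheaf_epi X F G \<phi> \<longleftrightarrow> (\<forall>U. openin X U \<longrightarrow> sheaf_image X F G \<phi> U = carrier (sect G U))"

definition exact_at ::
  "'a topology \<Rightarrow> ('a, 'l) mod_sheaf \<Rightarrow> ('a set \<Rightarrow> 'l \<Rightarrow> 'm) \<Rightarrow> ('a, 'm) mod_sheaf \<Rightarrow>
     ('a set \<Rightarrow> 'm \<Rightarrow> 'k) \<Rightarrow> ('a, 'k) mod_sheaf \<Rightarrow> bool" where
  "exact_at X F \<phi> G \<psi> H \<longleftrightarrow>
     (\<forall>U. openin X U \<longrightarrow> sheaf_image X F G \<phi> U = sheaf_kernel G H \<psi> U)"


section \<open>Locally free and coherent sheaves\<close>

definition free_sheaf :: "'a function_sheaf \<Rightarrow> nat \<Rightarrow> ('a, nat \<Rightarrow> 'a \<Rightarrow> complex) mod_sheaf" where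
  "free_sheaf \<O> r =
     \<lparr>sect = (\<lambda>U. \<lparr>carrier = (\<Pi>\<^sub>E i\<in>{..<r}. carrier (\<O> U)), mult = undefined, one = undefined,
                   zero = (\<lambda>i\<in>{..<r}. \<zero>\<^bsub>\<O> U\<^esub>),
                   add = (\<lambda>s t. \<lambda>i\<in>{..<r}. s i \<oplus>\<^bsub>\<O> U\<^esub> t i),
                   smult = (\<lambda>f s. \<lambda>i\<in>{..<r}. f \<otimes>\<^bsub>\<O> U\<^esub> s i)\<rparr>),
      restr = (\<lambda>U V s. \<lambda>i\<in>{..<r}. restrict (s i) V)\<rparr>"

definition locally_free_finite_rank :: "'a topology \<Rightarrow> 'a function_sheaf \<Rightarrow> ('a, 'm) mod_sheaf \<Rightarrow> bool" where
  "locally_free_finite_rank X \<O> F \<longleftrightarrow> module_sheaf X \<O> F \<and>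
     (\<forall>x\<in>topspace X. \<exists>U r. openin X U \<and> x \<in> U \<and>
        (\<exists>\<phi>\<in>sheaf_hom (subtopology X U) \<O> (free_sheaf \<O> r) F.
           sheaf_iso (subtopology X U) (free_sheaf \<O> r) F \<phi>))"

definition finite_type :: "'a topology \<Rightarrow> 'a function_sheaf \<Rightarrow> ('a, 'm) mod_sheaf \<Rightarrow> bool" where
  "finite_type X \<O> F \<longleftrightarrow>
     (\<forall>x\<in>topspace X. \<exists>U r. openin X U \<and> x \<in> U \<and>
        (\<exists>\<phi>\<in>sheaf_hom (subtopology X U) \<O> (free_sheaf \<O> r) F.
           sheaf_epi (subtopology X U) (free_sheaf \<O> r) F \<phi>))"

definition kernel_sheaf ::
  "('a, 'm) mod_sheaf \<Rightarrow> ('a, 'k) mod_sheaf \<Rightarrow> ('a set \<Rightarrow> 'm \<Rightarrow> 'k) \<Rightarrow> ('a, 'm) mod_sheaf" where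
  "kernel_sheaf F G \<phi> =
     \<lparr>sect = (\<lambda>U. (sect F U)\<lparr>carrier := sheaf_kernel F G \<phi> U\<rparr>), restr = restr F\<rparr>"

definition coherent :: "'a topology \<Rightarrow> 'a function_sheaf \<Rightarrow> ('a, 'm) mod_sheaf \<Rightarrow> bool" where
  "coherent X \<O> F \<longleftrightarrow> module_sheaf X \<O> F \<and> finite_type X \<O> F \<and>
     (\<forall>U r. openin X U \<longrightarrow>
        (\<forall>\<phi>\<in>sheaf_hom (subtopology X U) \<O> (free_sheaf \<O> r) F.
           finite_type (subtopology X U) \<O> (kernel_sheaf (free_sheaf \<O> r) F \<phi>)))"


section \<open>Injective resolutions\<close>

text \<open>
  The extension property is required for all \<open>A\<close>, \<open>B\<close> whose sections live in the same type
  \<open>'m\<close> as those of \<open>I\<close>, since a formula cannot quantify over types.  For the structure sheaf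
  of a complex manifold this is injectivity in the category of all sheaves of modules: by Baer's
  criterion it suffices to extend morphisms from subsheaves \<open>A\<close> of the extensions by zero \<open>B\<close>
  of \<open>\<O>\<close> restricted to open sets.  The section sets of these have at most the cardinality of
  the continuum, by second countability, and therefore have copies in \<open>'m\<close> as soon as \<open>I\<close>
  has a nonzero section, as that section then has continuum many multiples.
\<close>

definition injective_sheaf :: "'a topology \<Rightarrow> 'a function_sheaf \<Rightarrow> ('a, 'm) mod_sheaf \<Rightarrow> bool" where
  "injective_sheaf X \<O> I \<longleftrightarrow> module_sheaf X \<O> I \<and>
     (\<forall>(A :: ('a, 'm) mod_sheaf) (B :: ('a, 'm) mod_sheaf). module_sheaf X \<O> A \<and> module_sheaf X \<O> B \<longrightarrow>
        (\<forall>\<iota>\<in>sheaf_hom X \<O> A B. \<forall>\<phi>\<in>sheaf_hom X \<O> A I. sheaf_mono X A \<iota> \<longrightarrow>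
           (\<exists>\<psi>\<in>sheaf_hom X \<O> B I. \<forall>U. openin X U \<longrightarrow>
              (\<forall>s\<in>carrier (sect A U). \<psi> U (\<iota> U s) = \<phi> U s))))"

text \<open>\<open>0 \<rightarrow> F \<rightarrow> I 0 \<rightarrow> I 1 \<rightarrow> \<dots>\<close> with augmentation \<open>\<epsilon>\<close> and differentials \<open>d\<close>.\<close>

definition injective_resolution ::
  "'a topology \<Rightarrow> 'a function_sheaf \<Rightarrow> ('a, 'f) mod_sheaf \<Rightarrow> (nat \<Rightarrow> ('a, 'm) mod_sheaf) \<Rightarrow>
     (nat \<Rightarrow> 'a set \<Rightarrow> 'm \<Rightarrow> 'm) \<Rightarrow> ('a set \<Rightarrow> 'f \<Rightarrow> 'm) \<Rightarrow> bool" where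
  "injective_resolution X \<O> F I d \<epsilon> \<longleftrightarrow> module_sheaf X \<O> F \<and>
     (\<forall>q. injective_sheaf X \<O> (I q) \<and> d q \<in> sheaf_hom X \<O> (I q) (I (Suc q))) \<and>
     \<epsilon> \<in> sheaf_hom X \<O> F (I 0) \<and> sheaf_mono X F \<epsilon> \<and>
     exact_at X F \<epsilon> (I 0) (d 0) (I 1) \<and>
     (\<forall>q. exact_at X (I q) (d q) (I (Suc q)) (d (Suc q)) (I (Suc (Suc q))))"


section \<open>Sheafification\<close>

definition germ ::
  "'a topology \<Rightarrow> ('a, 'm) mod_sheaf \<Rightarrow> 'a \<Rightarrow> 'a set \<Rightarrow> 'm \<Rightarrow> ('a set \<times> 'm) set" where
  "germ X P x V s = {(W, t). openin X W \<and> x \<in> W \<and> t \<in> carrier (sect P W) \<and>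
     (\<exists>N. openin X N \<and> x \<in> N \<and> N \<subseteq> V \<inter> W \<and> restr P V N s = restr P W N t)}"

text \<open>
  Sections are functions into the stalks that locally come from sections of the presheaf.  Each
  union below ranges over the representatives of given germs; all its members coincide, so that
  it is the germ computed from any choice of representatives.
\<close>

definition sheafify ::
  "'a topology \<Rightarrow> ('a, 'm) mod_sheaf \<Rightarrow> ('a, 'a \<Rightarrow> ('a set \<times> 'm) set) mod_sheaf" where
  "sheafify X P =
     \<lparr>sect = (\<lambda>U.
        \<lparr>carrier = {s \<in> extensional U. \<forall>x\<in>U. \<exists>V. openin X V \<and> x \<in> V \<and> V \<subseteq> U \<and>
                      (\<exists>t\<in>carrier (sect P V). \<forall>y\<in>V. s y = germ X P y V t)},
         mult = undefined, one = undefined,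
         zero = (\<lambda>x\<in>U. germ X P x U \<zero>\<^bsub>sect P U\<^esub>),
         add = (\<lambda>s s'. \<lambda>x\<in>U. \<Union>(V, a)\<in>s x. \<Union>(W, b)\<in>s' x.
                  germ X P x (V \<inter> W)
                    (restr P V (V \<inter> W) a \<oplus>\<^bsub>sect P (V \<inter> W)\<^esub> restr P W (V \<inter> W) b)),
         smult = (\<lambda>f s. \<lambda>x\<in>U. \<Union>(V, a)\<in>s x.
                  germ X P x (U \<inter> V)
                    (restrict f (U \<inter> V) \<odot>\<^bsub>sect P (U \<inter> V)\<^esub> restr P V (U \<inter> V) a))\<rparr>),
      restr = (\<lambda>U V s. restrict s V)\<rparr>"


section \<open>Cohomology of complexes of sheaves\<close>

definition quot_module :: "('r, 'm) module \<Rightarrow> 'm set \<Rightarrow> ('r, 'm set) module" where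
  "quot_module M N =
     \<lparr>carrier = a_rcosets\<^bsub>M\<^esub> N, mult = undefined, one = undefined, zero = N, add = set_add M,
      smult = (\<lambda>r C. \<Union>c\<in>C. N +>\<^bsub>M\<^esub> (r \<odot>\<^bsub>M\<^esub> c))\<rparr>"

definition cocycles ::
  "(nat \<Rightarrow> ('a, 'm) mod_sheaf) \<Rightarrow> (nat \<Rightarrow> 'a set \<Rightarrow> 'm \<Rightarrow> 'm) \<Rightarrow> nat \<Rightarrow> 'a set \<Rightarrow> 'm set" where
  "cocycles C d k U = sheaf_kernel (C k) (C (Suc k)) (d k) U"

definition coboundaries ::
  "(nat \<Rightarrow> ('a, 'm) mod_sheaf) \<Rightarrow> (nat \<Rightarrow> 'a set \<Rightarrow> 'm \<Rightarrow> 'm) \<Rightarrow> nat \<Rightarrow> 'a set \<Rightarrow> 'm set" where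
  "coboundaries C d k U =
     (case k of 0 \<Rightarrow> {\<zero>\<^bsub>sect (C 0) U\<^esub>} | Suc j \<Rightarrow> d j U ` carrier (sect (C j) U))"

text \<open>The presheaf that assigns to \<open>U\<close> the \<open>k\<close>-th cohomology module of the complex of sections
  over \<open>U\<close>.\<close>

definition cohomology_presheaf ::
  "(nat \<Rightarrow> ('a, 'm) mod_sheaf) \<Rightarrow> (nat \<Rightarrow> 'a set \<Rightarrow> 'm \<Rightarrow> 'm) \<Rightarrow> nat \<Rightarrow> ('a, 'm set) mod_sheaf" where
  "cohomology_presheaf C d k =
     \<lparr>sect = (\<lambda>U. quot_module ((sect (C k) U)\<lparr>carrier := cocycles C d k U\<rparr>) (coboundaries C d k U)),
      restr = (\<lambda>U V c. \<Union>s\<in>c. coboundaries C d k V +>\<^bsub>sect (C k) V\<^esub> restr (C k) U V s)\<rparr>"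

text \<open>The \<open>k\<close>-th cohomology sheaf of a complex of sheaves, kernel modulo image in the category of
  sheaves.\<close>

definition cohomology_sheaf ::
  "'a topology \<Rightarrow> (nat \<Rightarrow> ('a, 'm) mod_sheaf) \<Rightarrow> (nat \<Rightarrow> 'a set \<Rightarrow> 'm \<Rightarrow> 'm) \<Rightarrow> nat \<Rightarrow>
     ('a, 'a \<Rightarrow> ('a set \<times> 'm set) set) mod_sheaf" where
  "cohomology_sheaf X C d k = sheafify X (cohomology_presheaf C d k)"


section \<open>Sheaf Ext and sheaf cohomology\<close>

definition hom_sheaf ::
  "'a topology \<Rightarrow> 'a function_sheaf \<Rightarrow> ('a, 'm) mod_sheaf \<Rightarrow> ('a, 'k) mod_sheaf \<Rightarrow>
     ('a, 'a set \<Rightarrow> 'm \<Rightarrow> 'k) mod_sheaf" where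
  "hom_sheaf X \<O> F G =
     \<lparr>sect = (\<lambda>U.
        \<lparr>carrier = sheaf_hom (subtopology X U) \<O> F G,
         mult = undefined, one = undefined,
         zero = (\<lambda>V\<in>{V. openin (subtopology X U) V}. \<lambda>s\<in>carrier (sect F V). \<zero>\<^bsub>sect G V\<^esub>),
         add = (\<lambda>\<phi> \<psi>. \<lambda>V\<in>{V. openin (subtopology X U) V}. \<lambda>s\<in>carrier (sect F V).
                  \<phi> V s \<oplus>\<^bsub>sect G V\<^esub> \<psi> V s),
         smult = (\<lambda>f \<phi>. \<lambda>V\<in>{V. openin (subtopology X U) V}. \<lambda>s\<in>carrier (sect F V).
                  restrict f V \<odot>\<^bsub>sect G V\<^esub> \<phi> V s)\<rparr>),
      restr = (\<lambda>U W \<phi>. restrict \<phi> {V. openin (subtopology X W) V})\<rparr>"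

text \<open>Composition with \<open>d\<close>, as a map from morphisms defined over \<open>U\<close> to morphisms defined
  over \<open>U\<close>.\<close>

definition hom_postcompose ::
  "'a topology \<Rightarrow> ('a, 'm) mod_sheaf \<Rightarrow> ('a set \<Rightarrow> 'k \<Rightarrow> 'l) \<Rightarrow>
     'a set \<Rightarrow> ('a set \<Rightarrow> 'm \<Rightarrow> 'k) \<Rightarrow> ('a set \<Rightarrow> 'm \<Rightarrow> 'l)" where
  "hom_postcompose X F d U \<phi> =
     (\<lambda>V\<in>{V. openin (subtopology X U) V}. \<lambda>s\<in>carrier (sect F V). d V (\<phi> V s))"

text \<open>The sheaf \<open>Ext\<^sup>k(F, G) = H\<^sup>k(R Hom(F, G))\<close>, computed from an injective resolution
  \<open>(I, d)\<close> of \<open>G\<close>.\<close>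

definition sheaf_Ext ::
  "'a topology \<Rightarrow> 'a function_sheaf \<Rightarrow> ('a, 'm) mod_sheaf \<Rightarrow> (nat \<Rightarrow> ('a, 'k) mod_sheaf) \<Rightarrow>
     (nat \<Rightarrow> 'a set \<Rightarrow> 'k \<Rightarrow> 'k) \<Rightarrow> nat \<Rightarrow>
     ('a, 'a \<Rightarrow> ('a set \<times> ('a set \<Rightarrow> 'm \<Rightarrow> 'k) set) set) mod_sheaf" where
  "sheaf_Ext X \<O> F I d k =
     cohomology_sheaf X (\<lambda>q. hom_sheaf X \<O> F (I q)) (\<lambda>q. hom_postcompose X F (d q)) k"

text \<open>The group \<open>H\<^sup>q(X, F)\<close>, computed from an injective resolution \<open>(J, d)\<close> of \<open>F\<close>.\<close>

definition sheaf_cohomology ::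
  "'a topology \<Rightarrow> (nat \<Rightarrow> ('a, 'm) mod_sheaf) \<Rightarrow> (nat \<Rightarrow> 'a set \<Rightarrow> 'm \<Rightarrow> 'm) \<Rightarrow> nat \<Rightarrow>
     ('a \<Rightarrow> complex, 'm set) module" where
  "sheaf_cohomology X J d q = sect (cohomology_presheaf J d q) (topspace X)"

text \<open>The direct sum of the groups \<open>H\<^sup>q(X, Ext\<^sup>k(F, G))\<close> over all \<open>q\<close>, where \<open>(J, d)\<close> is an
  injective resolution of \<open>Ext\<^sup>k(F, G)\<close>.\<close>

definition vertex_operators ::
  "'a topology \<Rightarrow> (nat \<Rightarrow> ('a, 'm) mod_sheaf) \<Rightarrow> (nat \<Rightarrow> 'a set \<Rightarrow> 'm \<Rightarrow> 'm) \<Rightarrow> (nat \<Rightarrow> 'm set) monoid" where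
  "vertex_operators X J d = sum_group UNIV (\<lambda>q. add_monoid (sheaf_cohomology X J d q))"

end

theory Submission
  imports Defs
begin

text \<open>
  The vanishing has two sources: a locally free sheaf is locally projective, and a
  bounded below exact complex of injective sheaves splits.

  A \<open>k\<close>-cocycle of the complex \<open>Hom(E, I)\<close> over \<open>U\<close> is a morphism \<open>\<phi> : E \<rightarrow> I k\<close> over \<open>U\<close>
  that is killed by the differential.  For \<open>k > 0\<close> exactness of \<open>I\<close> lifts every single value of
  \<open>\<phi>\<close> locally to \<open>I (k - 1)\<close>.  Where \<open>E\<close> is free, it suffices to lift the finitely many values
  on a basis; these lift over a common neighbourhood, and linear extension turns the lifts into
  a morphism \<open>\<eta>\<close> with \<open>d \<eta> = \<phi>\<close> (\<open>locally_free_lift\<close>).  So every class in the cohomology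
  presheaf of \<open>Hom(E, I)\<close> becomes zero near every point (\<open>Ext_class_locally_zero\<close>), all its germs
  at a point agree, and the sheaf \<open>Ext\<^sup>k(E, G)\<close> has at most one section over each open set
  (\<open>sheaf_Ext_subsingleton\<close>).

  It remains to see that an injective resolution \<open>J\<close> of a zero sheaf is exact on sections over
  every open set, although exactness of sheaves only gives local lifts.  Inductively one finds an
  endomorphism \<open>\<pi>\<close> of \<open>J q\<close> that projects onto the kernel of \<open>d q\<close>.  Then \<open>d q\<close> is injective
  on the kernel of \<open>\<pi>\<close>, injectivity of \<open>J q\<close> provides \<open>\<psi> : J (Suc q) \<rightarrow> J q\<close> that inverts
  \<open>d q\<close> there, and \<open>d q \<circ> \<psi>\<close> is the next projection (\<open>kernel_projection_step\<close>).  It fixes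
  cocycles and has coboundaries as values, so that all cocycles over an open set are coboundaries.
  The kernel of \<open>\<pi>\<close> is a subsheaf of \<open>J q\<close>; the extension property is therefore used only for
  sheaves whose sections have the same type as those of \<open>J q\<close>, as \<^const>\<open>injective_sheaf\<close>
  demands.
\<close>


section \<open>Linear maps and free modules\<close>

text \<open>
  This is the condition that \<^const>\<open>sheaf_hom\<close> imposes on each component of a morphism.
\<close>

definition linear_maps :: "('r, 'x) ring_scheme \<Rightarrow> ('r, 'm, 'y) module_scheme \<Rightarrow> ('r, 'k, 'z) module_scheme \<Rightarrow> ('m \<Rightarrow> 'k) set"
  where "linear_maps R M N = {h \<in> hom (add_monoid M) (add_monoid N).
     \<forall>f\<in>carrier R. \<forall>s\<in>carrier M. h (f \<odot>\<^bsub>M\<^esub> s) = f \<odot>\<^bsub>N\<^esub> h s}"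

lemma linear_mapsI:
  assumes "\<And>s. s \<in> carrier M \<Longrightarrow> h s \<in> carrier N"
    and "\<And>s t. s \<in> carrier M \<Longrightarrow> t \<in> carrier M \<Longrightarrow> h (s \<oplus>\<^bsub>M\<^esub> t) = h s \<oplus>\<^bsub>N\<^esub> h t"
    and "\<And>f s. f \<in> carrier R \<Longrightarrow> s \<in> carrier M \<Longrightarrow> h (f \<odot>\<^bsub>M\<^esub> s) = f \<odot>\<^bsub>N\<^esub> h s"
  shows "h \<in> linear_maps R M N"
  using assms by (auto simp: linear_maps_def hom_def)

lemma linear_mapsD:
  assumes "h \<in> linear_maps R M N"
  shows linear_maps_closed: "s \<in> carrier M \<Longrightarrow> h s \<in> carrier N"
    and linear_maps_add: "s \<in> carrier M \<Longrightarrow> t \<in> carrier M \<Longrightarrow> h (s \<oplus>\<^bsub>M\<^esub> t) = h s \<oplus>\<^bsub>N\<^esub> h t"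
    and linear_maps_smult: "f \<in> carrier R \<Longrightarrow> s \<in> carrier M \<Longrightarrow> h (f \<odot>\<^bsub>M\<^esub> s) = f \<odot>\<^bsub>N\<^esub> h s"
  using assms by (auto simp: linear_maps_def hom_def)

lemma linear_maps_comp:
  assumes "g \<in> linear_maps R M N" "h \<in> linear_maps R N P"
  shows "(\<lambda>s. h (g s)) \<in> linear_maps R M P"
  by (rule linear_mapsI)
    (simp_all add: linear_mapsD[OF assms(1)] linear_mapsD[OF assms(2)])

lemma linear_maps_restrict:
  assumes "module R M" and h: "h \<in> linear_maps R M N"
  shows "restrict h (carrier M) \<in> linear_maps R M N"
proof -
  interpret module R M by fact
  show ?thesis by (rule linear_mapsI) (simp_all add: linear_mapsD[OF h])
qed

text \<open>
  Stated for a domain that is closed under its operations, so that it applies to the record of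
  sections of a free sheaf straight from its definition.
\<close>

lemma linear_maps_inverse:
  assumes h: "h \<in> linear_maps R M N" and bij: "bij_betw h (carrier M) (carrier N)"
    and add: "\<And>a b. a \<in> carrier M \<Longrightarrow> b \<in> carrier M \<Longrightarrow> a \<oplus>\<^bsub>M\<^esub> b \<in> carrier M"
    and smult: "\<And>f a. f \<in> carrier R \<Longrightarrow> a \<in> carrier M \<Longrightarrow> f \<odot>\<^bsub>M\<^esub> a \<in> carrier M"
  shows "inv_into (carrier M) h \<in> linear_maps R N M"
proof -
  let ?c = "inv_into (carrier M) h"
  have c: "?c s \<in> carrier M" "h (?c s) = s" if "s \<in> carrier N" for s
    using that bij bij_betw_imp_surj_on[OF bij] by (auto intro: inv_into_into f_inv_into_f)
  have eq: "?c s = a" if "a \<in> carrier M" "h a = s" for a s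
    using bij_betw_inv_into_left[OF bij that(1)] that(2) by simp
  show ?thesis
  proof (rule linear_mapsI)
    show "?c (s \<oplus>\<^bsub>N\<^esub> t) = ?c s \<oplus>\<^bsub>M\<^esub> ?c t" if "s \<in> carrier N" "t \<in> carrier N" for s t
      by (rule eq) (simp_all add: that c add linear_maps_add[OF h])
    show "?c (f \<odot>\<^bsub>N\<^esub> s) = f \<odot>\<^bsub>M\<^esub> ?c s" if "f \<in> carrier R" "s \<in> carrier N" for f s
      by (rule eq) (simp_all add: that c smult linear_maps_smult[OF h])
  qed (rule c)
qed

lemma additive_zero:
  assumes "abelian_group M" "abelian_group N" "h \<in> hom (add_monoid M) (add_monoid N)"
  shows "h \<zero>\<^bsub>M\<^esub> = \<zero>\<^bsub>N\<^esub>"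
  using hom_one[of h "add_monoid M" "add_monoid N"] assms
  by (simp add: abelian_group.a_group)

lemma additive_a_inv:
  assumes "abelian_group M" "abelian_group N" "h \<in> hom (add_monoid M) (add_monoid N)"
    and "s \<in> carrier M"
  shows "h (\<ominus>\<^bsub>M\<^esub> s) = \<ominus>\<^bsub>N\<^esub> h s"
proof -
  interpret group_hom "add_monoid M" "add_monoid N" h
    using assms by (simp add: group_hom_def group_hom_axioms_def abelian_group.a_group)
  show ?thesis using hom_inv[of s] assms(4) by (simp add: a_inv_def)
qed

lemma additive_finsum:
  assumes M: "abelian_group M" and N: "abelian_group N"
    and h: "h \<in> hom (add_monoid M) (add_monoid N)"
    and "finite B" and "g \<in> B \<rightarrow> carrier M"
  shows "h (finsum M g B) = finsum N (\<lambda>i. h (g i)) B"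
proof -
  interpret M: abelian_group M by (rule M)
  interpret N: abelian_group N by (rule N)
  have hc: "h s \<in> carrier N" if "s \<in> carrier M" for s
    using h that by (auto simp: hom_def)
  show ?thesis
    using assms(4,5)
  proof (induction B)
    case empty
    show ?case by (simp add: additive_zero[OF M N h])
  next
    case (insert i B)
    then have "h (g i \<oplus>\<^bsub>M\<^esub> finsum M g B) = h (g i) \<oplus>\<^bsub>N\<^esub> h (finsum M g B)"
      using h by (auto simp: hom_def)
    with insert show ?case
      by (simp add: Pi_iff hc)
  qed
qed

lemma linear_combination_linear:
  assumes "module R N" and "t \<in> {..<r} \<rightarrow> carrier N" and O: "\<O> U = R"
  shows "(\<lambda>a. \<Oplus>\<^bsub>N\<^esub> i\<in>{..<r}. a i \<odot>\<^bsub>N\<^esub> t i) \<in> linear_maps R (sect (free_sheaf \<O> r) U) N"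
proof -
  interpret module R N by fact
  have t: "t i \<in> carrier N" if "i < r" for i using assms(2) that by auto
  have [simp]: "a i \<odot>\<^bsub>N\<^esub> t i \<in> carrier N" if "a \<in> (\<Pi>\<^sub>E i\<in>{..<r}. carrier R)" "i < r" for a i
    using that t by (auto intro!: smult_closed)
  show ?thesis
  proof (rule linear_mapsI)
    fix a assume "a \<in> carrier (sect (free_sheaf \<O> r) U)"
    then show "(\<Oplus>\<^bsub>N\<^esub> i\<in>{..<r}. a i \<odot>\<^bsub>N\<^esub> t i) \<in> carrier N"
      by (intro M.finsum_closed) (auto simp: free_sheaf_def O)
  next
    fix a b assume ab: "a \<in> carrier (sect (free_sheaf \<O> r) U)" "b \<in> carrier (sect (free_sheaf \<O> r) U)"
    then have ab': "a \<in> (\<Pi>\<^sub>E i\<in>{..<r}. carrier R)" "b \<in> (\<Pi>\<^sub>E i\<in>{..<r}. carrier R)"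
      by (auto simp: free_sheaf_def O)
    have "(\<Oplus>\<^bsub>N\<^esub> i\<in>{..<r}. (a \<oplus>\<^bsub>sect (free_sheaf \<O> r) U\<^esub> b) i \<odot>\<^bsub>N\<^esub> t i)
      = (\<Oplus>\<^bsub>N\<^esub> i\<in>{..<r}. a i \<odot>\<^bsub>N\<^esub> t i \<oplus>\<^bsub>N\<^esub> b i \<odot>\<^bsub>N\<^esub> t i)"
    proof (rule M.finsum_cong')
      fix i assume "i \<in> {..<r}"
      then show "(a \<oplus>\<^bsub>sect (free_sheaf \<O> r) U\<^esub> b) i \<odot>\<^bsub>N\<^esub> t i = a i \<odot>\<^bsub>N\<^esub> t i \<oplus>\<^bsub>N\<^esub> b i \<odot>\<^bsub>N\<^esub> t i"
        using ab' t by (auto simp: free_sheaf_def O intro!: smult_l_distr)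
    qed (use ab' in auto)
    also have "\<dots> = (\<Oplus>\<^bsub>N\<^esub> i\<in>{..<r}. a i \<odot>\<^bsub>N\<^esub> t i) \<oplus>\<^bsub>N\<^esub> (\<Oplus>\<^bsub>N\<^esub> i\<in>{..<r}. b i \<odot>\<^bsub>N\<^esub> t i)"
      using ab' by (intro M.finsum_addf) auto
    finally show "(\<Oplus>\<^bsub>N\<^esub> i\<in>{..<r}. (a \<oplus>\<^bsub>sect (free_sheaf \<O> r) U\<^esub> b) i \<odot>\<^bsub>N\<^esub> t i)
      = (\<Oplus>\<^bsub>N\<^esub> i\<in>{..<r}. a i \<odot>\<^bsub>N\<^esub> t i) \<oplus>\<^bsub>N\<^esub> (\<Oplus>\<^bsub>N\<^esub> i\<in>{..<r}. b i \<odot>\<^bsub>N\<^esub> t i)" .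
  next
    fix f a assume f: "f \<in> carrier R" and "a \<in> carrier (sect (free_sheaf \<O> r) U)"
    then have a: "a \<in> (\<Pi>\<^sub>E i\<in>{..<r}. carrier R)" by (auto simp: free_sheaf_def O)
    have "f \<odot>\<^bsub>N\<^esub> (\<Oplus>\<^bsub>N\<^esub> i\<in>{..<r}. a i \<odot>\<^bsub>N\<^esub> t i) = (\<Oplus>\<^bsub>N\<^esub> i\<in>{..<r}. f \<odot>\<^bsub>N\<^esub> (a i \<odot>\<^bsub>N\<^esub> t i))"
      using f a by (intro finsum_smult_ldistr) auto
    also have "\<dots> = (\<Oplus>\<^bsub>N\<^esub> i\<in>{..<r}. (f \<odot>\<^bsub>sect (free_sheaf \<O> r) U\<^esub> a) i \<odot>\<^bsub>N\<^esub> t i)"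
    proof (rule M.finsum_cong')
      show "(\<lambda>i. (f \<odot>\<^bsub>sect (free_sheaf \<O> r) U\<^esub> a) i \<odot>\<^bsub>N\<^esub> t i) \<in> {..<r} \<rightarrow> carrier N"
        using f a t by (auto simp: free_sheaf_def O PiE_iff intro!: smult_closed)
      fix i assume "i \<in> {..<r}"
      then show "f \<odot>\<^bsub>N\<^esub> (a i \<odot>\<^bsub>N\<^esub> t i) = (f \<odot>\<^bsub>sect (free_sheaf \<O> r) U\<^esub> a) i \<odot>\<^bsub>N\<^esub> t i"
        using f a t by (subst smult_assoc1[symmetric]) (auto simp: free_sheaf_def O)
    qed simp
    finally show "(\<Oplus>\<^bsub>N\<^esub> i\<in>{..<r}. (f \<odot>\<^bsub>sect (free_sheaf \<O> r) U\<^esub> a) i \<odot>\<^bsub>N\<^esub> t i)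
       = f \<odot>\<^bsub>N\<^esub> (\<Oplus>\<^bsub>N\<^esub> i\<in>{..<r}. a i \<odot>\<^bsub>N\<^esub> t i)" by simp
  qed
qed

definition basis_section :: "'a function_sheaf \<Rightarrow> nat \<Rightarrow> 'a set \<Rightarrow> nat \<Rightarrow> nat \<Rightarrow> 'a \<Rightarrow> complex" where
  "basis_section \<O> r U i = (\<lambda>j\<in>{..<r}. if j = i then \<one>\<^bsub>\<O> U\<^esub> else \<zero>\<^bsub>\<O> U\<^esub>)"

lemma basis_section_closed:
  assumes "cring (\<O> U)"
  shows "basis_section \<O> r U i \<in> carrier (sect (free_sheaf \<O> r) U)"
proof -
  interpret cring "\<O> U" by fact
  show ?thesis by (auto simp: basis_section_def free_sheaf_def)
qed

text \<open>
  Together with the previous construction of linear maps from arbitrary values on the basis, this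
  is the freeness of \<open>R\<^sup>r\<close>: a section is the combination of the basis sections with its own
  entries as coefficients, and a linear map respects that.
\<close>

lemma linear_map_eq_combination:
  assumes "module (\<O> U) N" and h: "h \<in> linear_maps (\<O> U) (sect (free_sheaf \<O> r) U) N"
    and a: "a \<in> carrier (sect (free_sheaf \<O> r) U)"
  shows "h a = (\<Oplus>\<^bsub>N\<^esub> i\<in>{..<r}. a i \<odot>\<^bsub>N\<^esub> h (basis_section \<O> r U i))"
proof -
  interpret module "\<O> U" N by fact
  let ?F = "sect (free_sheaf \<O> r) U"
  let ?e = "basis_section \<O> r U"
  \<comment> \<open>Replacing the entries of \<open>a\<close> from index \<open>m\<close> on by zero allows induction on the number of terms
    without forming sums in the free module itself.\<close>
  define trunc where "trunc m = (\<lambda>j\<in>{..<r}. if j < m then a j else \<zero>\<^bsub>\<O> U\<^esub>)" for m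
  have a': "a \<in> extensional {..<r}" "\<And>i. i < r \<Longrightarrow> a i \<in> carrier (\<O> U)"
    using a by (simp_all add: free_sheaf_def PiE_iff)
  have trunc: "trunc m \<in> carrier ?F" for m
    using a' by (auto simp: trunc_def free_sheaf_def)
  have e: "?e i \<in> carrier ?F" for i
    by (rule basis_section_closed) (rule R.is_cring)
  have he: "h (?e i) \<in> carrier N" for i by (rule linear_maps_closed[OF h e])
  have "h (trunc m) = (\<Oplus>\<^bsub>N\<^esub> i\<in>{..<m}. a i \<odot>\<^bsub>N\<^esub> h (?e i))" if "m \<le> r" for m
    using that
  proof (induction m)
    case 0
    have "trunc 0 \<oplus>\<^bsub>?F\<^esub> trunc 0 = trunc 0"
      by (auto simp: trunc_def free_sheaf_def fun_eq_iff)
    then have "h (trunc 0) \<oplus>\<^bsub>N\<^esub> h (trunc 0) = h (trunc 0)"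
      using linear_maps_add[OF h trunc trunc] by metis
    then have "h (trunc 0) = \<zero>\<^bsub>N\<^esub>"
      using linear_maps_closed[OF h trunc] M.add.l_cancel_one by blast
    then show ?case by simp
  next
    case (Suc m)
    have ae: "a m \<odot>\<^bsub>?F\<^esub> ?e m \<in> carrier ?F"
      using Suc.prems a' by (auto simp: free_sheaf_def basis_section_def)
    have "trunc (Suc m) = a m \<odot>\<^bsub>?F\<^esub> ?e m \<oplus>\<^bsub>?F\<^esub> trunc m"
      using Suc.prems a' by (auto simp: trunc_def free_sheaf_def basis_section_def fun_eq_iff less_Suc_eq)
    then have "h (trunc (Suc m)) = a m \<odot>\<^bsub>N\<^esub> h (?e m) \<oplus>\<^bsub>N\<^esub> h (trunc m)"
      using linear_maps_add[OF h ae trunc] linear_maps_smult[OF h _ e] Suc.prems a' by simp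
    also have "\<dots> = (\<Oplus>\<^bsub>N\<^esub> i\<in>insert m {..<m}. a i \<odot>\<^bsub>N\<^esub> h (?e i))"
      using Suc a' he by (subst M.finsum_insert) (auto intro!: smult_closed)
    finally show ?case by (simp add: lessThan_Suc)
  qed
  moreover have "trunc r = a"
    using a' by (auto simp: trunc_def fun_eq_iff extensional_def)
  ultimately show ?thesis by auto
qed


section \<open>Presheaves of modules, sheaves and their morphisms\<close>

lemma module_presheafD:
  assumes "module_presheaf X \<O> F"
  shows presheaf_module: "openin X U \<Longrightarrow> module (\<O> U) (sect F U)"
    and presheaf_group: "openin X U \<Longrightarrow> abelian_group (sect F U)"
    and presheaf_restr_hom: "openin X U \<Longrightarrow> openin X V \<Longrightarrow> V \<subseteq> U \<Longrightarrow>
        restr F U V \<in> hom (add_monoid (sect F U)) (add_monoid (sect F V))"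
    and presheaf_restr_closed: "openin X U \<Longrightarrow> openin X V \<Longrightarrow> V \<subseteq> U \<Longrightarrow> s \<in> carrier (sect F U) \<Longrightarrow>
        restr F U V s \<in> carrier (sect F V)"
    and presheaf_restr_add: "openin X U \<Longrightarrow> openin X V \<Longrightarrow> V \<subseteq> U \<Longrightarrow> s \<in> carrier (sect F U) \<Longrightarrow>
        t \<in> carrier (sect F U) \<Longrightarrow> restr F U V (s \<oplus>\<^bsub>sect F U\<^esub> t) = restr F U V s \<oplus>\<^bsub>sect F V\<^esub> restr F U V t"
    and presheaf_restr_smult: "openin X U \<Longrightarrow> openin X V \<Longrightarrow> V \<subseteq> U \<Longrightarrow> f \<in> carrier (\<O> U) \<Longrightarrow>
        s \<in> carrier (sect F U) \<Longrightarrow> restr F U V (f \<odot>\<^bsub>sect F U\<^esub> s) = restrict f V \<odot>\<^bsub>sect F V\<^esub> restr F U V s"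
    and presheaf_restr_zero: "openin X U \<Longrightarrow> openin X V \<Longrightarrow> V \<subseteq> U \<Longrightarrow> restr F U V \<zero>\<^bsub>sect F U\<^esub> = \<zero>\<^bsub>sect F V\<^esub>"
    and presheaf_restr_id: "openin X U \<Longrightarrow> s \<in> carrier (sect F U) \<Longrightarrow> restr F U U s = s"
    and presheaf_restr_restr: "openin X U \<Longrightarrow> openin X V \<Longrightarrow> openin X W \<Longrightarrow> W \<subseteq> V \<Longrightarrow> V \<subseteq> U \<Longrightarrow>
        s \<in> carrier (sect F U) \<Longrightarrow> restr F V W (restr F U V s) = restr F U W s"
proof -
  show m: "module (\<O> U) (sect F U)" if "openin X U" for U
    using assms that by (simp add: module_presheaf_def)
  then show g: "abelian_group (sect F U)" if "openin X U" for U
    using that by (simp add: module_def)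
  show h: "restr F U V \<in> hom (add_monoid (sect F U)) (add_monoid (sect F V))"
    if "openin X U" "openin X V" "V \<subseteq> U" for U V
    using assms that by (simp add: module_presheaf_def)
  show "restr F U V s \<in> carrier (sect F V)"
    if "openin X U" "openin X V" "V \<subseteq> U" "s \<in> carrier (sect F U)" for U V s
    using h[of U V] that by (auto simp: hom_def)
  show "restr F U V (s \<oplus>\<^bsub>sect F U\<^esub> t) = restr F U V s \<oplus>\<^bsub>sect F V\<^esub> restr F U V t"
    if "openin X U" "openin X V" "V \<subseteq> U" "s \<in> carrier (sect F U)" "t \<in> carrier (sect F U)" for U V s t
    using h[of U V] that by (auto simp: hom_def)
  show "restr F U V (f \<odot>\<^bsub>sect F U\<^esub> s) = restrict f V \<odot>\<^bsub>sect F V\<^esub> restr F U V s"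
    if "openin X U" "openin X V" "V \<subseteq> U" "f \<in> carrier (\<O> U)" "s \<in> carrier (sect F U)" for U V f s
    using assms that by (simp add: module_presheaf_def)
  show "restr F U V \<zero>\<^bsub>sect F U\<^esub> = \<zero>\<^bsub>sect F V\<^esub>" if "openin X U" "openin X V" "V \<subseteq> U" for U V
    using additive_zero[OF g g h] that by simp
  show "restr F U U s = s" if "openin X U" "s \<in> carrier (sect F U)" for U s
    using assms that by (simp add: module_presheaf_def)
  show "restr F V W (restr F U V s) = restr F U W s"
    if "openin X U" "openin X V" "openin X W" "W \<subseteq> V" "V \<subseteq> U" "s \<in> carrier (sect F U)" for U V W s
    using assms that unfolding module_presheaf_def by blast
qed

lemma module_presheaf_subtopology:
  assumes "module_presheaf X \<O> F" "openin X U"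
  shows "module_presheaf (subtopology X U) \<O> F"
  unfolding module_presheaf_def openin_open_subtopology[OF assms(2)]
  using assms(1) by (simp add: module_presheaf_def)

lemma module_sheaf_presheaf: "module_sheaf X \<O> F \<Longrightarrow> module_presheaf X \<O> F"
  by (simp add: module_sheaf_def)

text \<open>
  The separation axiom in pointwise form: the open sets on which two sections agree cover \<open>U\<close>.
\<close>

lemma sheaf_eqI_local:
  assumes F: "module_sheaf X \<O> F" and U: "openin X U"
    and s: "s \<in> carrier (sect F U)" and t: "t \<in> carrier (sect F U)"
    and loc: "\<And>x. x \<in> U \<Longrightarrow> \<exists>V. openin X V \<and> x \<in> V \<and> V \<subseteq> U \<and> restr F U V s = restr F U V t"
  shows "s = t"
proof -
  define \<U> where "\<U> = {V. openin X V \<and> V \<subseteq> U \<and> restr F U V s = restr F U V t}"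
  have un: "\<Union>\<U> = U" using loc by (force simp: \<U>_def)
  have "\<forall>V\<in>\<U>. openin X V" by (simp add: \<U>_def)
  then have "\<forall>s\<in>carrier (sect F (\<Union>\<U>)). \<forall>t\<in>carrier (sect F (\<Union>\<U>)).
           (\<forall>V\<in>\<U>. restr F (\<Union>\<U>) V s = restr F (\<Union>\<U>) V t) \<longrightarrow> s = t"
    using F unfolding module_sheaf_def by meson
  then show ?thesis using s t unfolding un by (auto simp: \<U>_def)
qed

lemma sheaf_glue:
  assumes F: "module_sheaf X \<O> F" and "\<And>V. V \<in> \<U> \<Longrightarrow> openin X V"
    and "\<And>V. V \<in> \<U> \<Longrightarrow> s V \<in> carrier (sect F V)"
    and "\<And>V W. V \<in> \<U> \<Longrightarrow> W \<in> \<U> \<Longrightarrow> restr F V (V \<inter> W) (s V) = restr F W (V \<inter> W) (s W)"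
  obtains t where "t \<in> carrier (sect F (\<Union>\<U>))" "\<And>V. V \<in> \<U> \<Longrightarrow> restr F (\<Union>\<U>) V t = s V"
proof -
  have ax: "\<forall>\<U>. (\<forall>V\<in>\<U>. openin X V) \<longrightarrow>
        (\<forall>s\<in>carrier (sect F (\<Union>\<U>)). \<forall>t\<in>carrier (sect F (\<Union>\<U>)).
           (\<forall>V\<in>\<U>. restr F (\<Union>\<U>) V s = restr F (\<Union>\<U>) V t) \<longrightarrow> s = t) \<and>
        (\<forall>s. (\<forall>V\<in>\<U>. s V \<in> carrier (sect F V)) \<and>
             (\<forall>V\<in>\<U>. \<forall>W\<in>\<U>. restr F V (V \<inter> W) (s V) = restr F W (V \<inter> W) (s W)) \<longrightarrow>
             (\<exists>t\<in>carrier (sect F (\<Union>\<U>)). \<forall>V\<in>\<U>. restr F (\<Union>\<U>) V t = s V))"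
    using F unfolding module_sheaf_def by (rule conjunct2)
  have "\<exists>t\<in>carrier (sect F (\<Union>\<U>)). \<forall>V\<in>\<U>. restr F (\<Union>\<U>) V t = s V"
    by (rule mp[OF spec[OF conjunct2[OF mp[OF spec[OF ax, of \<U>]]], of s]])
      (intro conjI ballI impI assms(2-4); assumption)+
  then show ?thesis using that by blast
qed

lemma sheaf_homI:
  assumes "\<phi> \<in> extensional {U. openin X U}"
    and "\<And>U. openin X U \<Longrightarrow> \<phi> U \<in> extensional (carrier (sect F U))"
    and "\<And>U. openin X U \<Longrightarrow> \<phi> U \<in> linear_maps (\<O> U) (sect F U) (sect G U)"
    and "\<And>U V s. openin X U \<Longrightarrow> openin X V \<Longrightarrow> V \<subseteq> U \<Longrightarrow> s \<in> carrier (sect F U) \<Longrightarrow>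
           \<phi> V (restr F U V s) = restr G U V (\<phi> U s)"
  shows "\<phi> \<in> sheaf_hom X \<O> F G"
  using assms by (simp add: sheaf_hom_def linear_maps_def)

lemma sheaf_homD:
  assumes "\<phi> \<in> sheaf_hom X \<O> F G"
  shows sheaf_hom_extensional: "\<phi> \<in> extensional {U. openin X U}"
    and sheaf_hom_extensional_at: "openin X U \<Longrightarrow> \<phi> U \<in> extensional (carrier (sect F U))"
    and sheaf_hom_linear: "openin X U \<Longrightarrow> \<phi> U \<in> linear_maps (\<O> U) (sect F U) (sect G U)"
    and sheaf_hom_natural: "openin X U \<Longrightarrow> openin X V \<Longrightarrow> V \<subseteq> U \<Longrightarrow> s \<in> carrier (sect F U) \<Longrightarrow>
           \<phi> V (restr F U V s) = restr G U V (\<phi> U s)"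
    and sheaf_hom_closed: "openin X U \<Longrightarrow> s \<in> carrier (sect F U) \<Longrightarrow> \<phi> U s \<in> carrier (sect G U)"
    and sheaf_hom_additive: "openin X U \<Longrightarrow> \<phi> U \<in> hom (add_monoid (sect F U)) (add_monoid (sect G U))"
proof -
  show "\<phi> \<in> extensional {U. openin X U}"
    "openin X U \<Longrightarrow> \<phi> U \<in> extensional (carrier (sect F U))"
    "openin X U \<Longrightarrow> openin X V \<Longrightarrow> V \<subseteq> U \<Longrightarrow> s \<in> carrier (sect F U) \<Longrightarrow>
           \<phi> V (restr F U V s) = restr G U V (\<phi> U s)"
    using assms by (auto simp: sheaf_hom_def)
  show lin: "openin X U \<Longrightarrow> \<phi> U \<in> linear_maps (\<O> U) (sect F U) (sect G U)"
    using assms by (simp add: sheaf_hom_def linear_maps_def)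
  show "openin X U \<Longrightarrow> s \<in> carrier (sect F U) \<Longrightarrow> \<phi> U s \<in> carrier (sect G U)"
    using linear_maps_closed[OF lin] by simp
  show "openin X U \<Longrightarrow> \<phi> U \<in> hom (add_monoid (sect F U)) (add_monoid (sect G U))"
    using lin by (simp add: linear_maps_def)
qed

lemma sheaf_hom_eqI:
  assumes "\<phi> \<in> sheaf_hom X \<O> F G" "\<psi> \<in> sheaf_hom X \<O> F G"
    and "\<And>V s. openin X V \<Longrightarrow> s \<in> carrier (sect F V) \<Longrightarrow> \<phi> V s = \<psi> V s"
  shows "\<phi> = \<psi>"
proof (rule extensionalityI[OF sheaf_hom_extensional[OF assms(1)] sheaf_hom_extensional[OF assms(2)]])
  fix V assume "V \<in> {V. openin X V}"
  then have V: "openin X V" by simp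
  show "\<phi> V = \<psi> V"
    by (rule extensionalityI[OF sheaf_hom_extensional_at[OF assms(1) V]
          sheaf_hom_extensional_at[OF assms(2) V]]) (rule assms(3)[OF V])
qed

lemma sheaf_hom_restrict:
  assumes "\<phi> \<in> sheaf_hom (subtopology X U) \<O> F G" "openin X U" "openin X N" "N \<subseteq> U"
  shows "restrict \<phi> {V. openin (subtopology X N) V} \<in> sheaf_hom (subtopology X N) \<O> F G"
proof -
  have sub: "openin (subtopology X U) V" if "openin (subtopology X N) V" for V
    using that assms by (auto simp: openin_open_subtopology)
  show ?thesis
    by (rule sheaf_homI)
      (use sub sheaf_homD[OF assms(1)] in \<open>auto simp: restrict_def extensional_def\<close>)
qed

lemma hom_postcompose_apply:
  "openin (subtopology X U) V \<Longrightarrow> s \<in> carrier (sect F V) \<Longrightarrow> hom_postcompose X F d U \<phi> V s = d V (\<phi> V s)"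
  by (simp add: hom_postcompose_def)

lemma hom_postcompose_sheaf_hom:
  assumes F: "module_presheaf X \<O> F"
    and d: "d \<in> sheaf_hom X \<O> G H" and U: "openin X U" and \<phi>: "\<phi> \<in> sheaf_hom (subtopology X U) \<O> F G"
  shows "hom_postcompose X F d U \<phi> \<in> sheaf_hom (subtopology X U) \<O> F H"
proof -
  have sub: "openin X V" if "openin (subtopology X U) V" for V
    using that U by (simp add: openin_open_subtopology)
  note F' = module_presheaf_subtopology[OF F U]
  show ?thesis
  proof (rule sheaf_homI)
    fix V assume V: "openin (subtopology X U) V"
    note l = sheaf_hom_linear[OF \<phi> V] and l' = sheaf_hom_linear[OF d sub[OF V]]
    interpret module "\<O> V" "sect F V" by (rule presheaf_module[OF F' V])
    show "hom_postcompose X F d U \<phi> V \<in> linear_maps (\<O> V) (sect F V) (sect H V)"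
      by (rule linear_mapsI)
        (simp_all add: hom_postcompose_apply[OF V] linear_mapsD[OF l] linear_mapsD[OF l'])
  next
    fix W V s assume "openin (subtopology X U) W" "openin (subtopology X U) V" "V \<subseteq> W" "s \<in> carrier (sect F W)"
    then show "hom_postcompose X F d U \<phi> V (restr F W V s) = restr H W V (hom_postcompose X F d U \<phi> W s)"
      by (simp add: hom_postcompose_apply presheaf_restr_closed[OF F'] sheaf_hom_natural[OF \<phi>]
          sheaf_hom_natural[OF d] sub sheaf_hom_closed[OF \<phi>])
  qed (auto simp: hom_postcompose_def)
qed

lemma hom_sheaf_simps:
  "carrier (sect (hom_sheaf X \<O> F G) U) = sheaf_hom (subtopology X U) \<O> F G"
  "openin (subtopology X U) V \<Longrightarrow> s \<in> carrier (sect F V) \<Longrightarrow> \<zero>\<^bsub>sect (hom_sheaf X \<O> F G) U\<^esub> V s = \<zero>\<^bsub>sect G V\<^esub>"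
  "openin (subtopology X U) V \<Longrightarrow> s \<in> carrier (sect F V) \<Longrightarrow>
     (\<phi> \<oplus>\<^bsub>sect (hom_sheaf X \<O> F G) U\<^esub> \<psi>) V s = \<phi> V s \<oplus>\<^bsub>sect G V\<^esub> \<psi> V s"
  "restr (hom_sheaf X \<O> F G) U W \<phi> = restrict \<phi> {V. openin (subtopology X W) V}"
  by (simp_all add: hom_sheaf_def)

text \<open>
  The coset of the coboundaries by a coboundary is the zero class only because the morphisms over
  \<open>U\<close> form a group.
\<close>

lemma hom_sheaf_group:
  assumes F: "module_presheaf X \<O> F" and G: "module_presheaf X \<O> G" and U: "openin X U"
  shows "abelian_group (sect (hom_sheaf X \<O> F G) U)"
proof -
  let ?Y = "subtopology X U" and ?H = "sect (hom_sheaf X \<O> F G) U"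
  note F' = module_presheaf_subtopology[OF F U] and G' = module_presheaf_subtopology[OF G U]
  have add: "\<phi> \<oplus>\<^bsub>?H\<^esub> \<psi> \<in> sheaf_hom ?Y \<O> F G"
    if \<phi>: "\<phi> \<in> sheaf_hom ?Y \<O> F G" and \<psi>: "\<psi> \<in> sheaf_hom ?Y \<O> F G" for \<phi> \<psi>
  proof (rule sheaf_homI)
    fix V assume V: "openin ?Y V"
    interpret F: module "\<O> V" "sect F V" by (rule presheaf_module[OF F' V])
    interpret G: module "\<O> V" "sect G V" by (rule presheaf_module[OF G' V])
    note l = sheaf_hom_linear[OF \<phi> V] and l' = sheaf_hom_linear[OF \<psi> V]
    show "(\<phi> \<oplus>\<^bsub>?H\<^esub> \<psi>) V \<in> linear_maps (\<O> V) (sect F V) (sect G V)"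
      by (rule linear_mapsI)
        (simp_all add: hom_sheaf_simps V linear_mapsD[OF l] linear_mapsD[OF l'] G.smult_r_distr G.add.m_ac)
  next
    fix W V s assume "openin ?Y W" "openin ?Y V" "V \<subseteq> W" "s \<in> carrier (sect F W)"
    then show "(\<phi> \<oplus>\<^bsub>?H\<^esub> \<psi>) V (restr F W V s) = restr G W V ((\<phi> \<oplus>\<^bsub>?H\<^esub> \<psi>) W s)"
      by (simp add: hom_sheaf_simps presheaf_restr_closed[OF F'] presheaf_restr_add[OF G']
          sheaf_hom_natural[OF \<phi>] sheaf_hom_natural[OF \<psi>] sheaf_hom_closed[OF \<phi>] sheaf_hom_closed[OF \<psi>])
  qed (auto simp: hom_sheaf_def)
  have zero: "\<zero>\<^bsub>?H\<^esub> \<in> sheaf_hom ?Y \<O> F G"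
  proof (rule sheaf_homI)
    fix V assume V: "openin ?Y V"
    interpret F: module "\<O> V" "sect F V" by (rule presheaf_module[OF F' V])
    interpret G: module "\<O> V" "sect G V" by (rule presheaf_module[OF G' V])
    show "\<zero>\<^bsub>?H\<^esub> V \<in> linear_maps (\<O> V) (sect F V) (sect G V)"
      by (rule linear_mapsI) (auto simp: hom_sheaf_simps V)
  next
    fix W V s assume "openin ?Y W" "openin ?Y V" "V \<subseteq> W" "s \<in> carrier (sect F W)"
    then show "\<zero>\<^bsub>?H\<^esub> V (restr F W V s) = restr G W V (\<zero>\<^bsub>?H\<^esub> W s)"
      by (simp add: hom_sheaf_simps presheaf_restr_closed[OF F'] presheaf_restr_zero[OF G'])
  qed (auto simp: hom_sheaf_def)
  have neg: "\<exists>\<psi>\<in>sheaf_hom ?Y \<O> F G. \<psi> \<oplus>\<^bsub>?H\<^esub> \<phi> = \<zero>\<^bsub>?H\<^esub>"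
    if \<phi>: "\<phi> \<in> sheaf_hom ?Y \<O> F G" for \<phi>
  proof
    let ?\<psi> = "\<lambda>V\<in>{V. openin ?Y V}. \<lambda>s\<in>carrier (sect F V). \<ominus>\<^bsub>sect G V\<^esub> \<phi> V s"
    show \<psi>: "?\<psi> \<in> sheaf_hom ?Y \<O> F G"
    proof (rule sheaf_homI)
      fix V assume V: "openin ?Y V"
      interpret F: module "\<O> V" "sect F V" by (rule presheaf_module[OF F' V])
      interpret G: module "\<O> V" "sect G V" by (rule presheaf_module[OF G' V])
      note l = sheaf_hom_linear[OF \<phi> V]
      show "?\<psi> V \<in> linear_maps (\<O> V) (sect F V) (sect G V)"
        by (rule linear_mapsI)
          (simp_all add: V linear_mapsD[OF l] G.smult_r_minus G.minus_add)
    next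
      fix W V s assume a: "openin ?Y W" "openin ?Y V" "V \<subseteq> W" "s \<in> carrier (sect F W)"
      then show "?\<psi> V (restr F W V s) = restr G W V (?\<psi> W s)"
        by (simp add: presheaf_restr_closed[OF F'] sheaf_hom_natural[OF \<phi>] sheaf_hom_closed[OF \<phi>]
           additive_a_inv[OF presheaf_group[OF G'] presheaf_group[OF G'] presheaf_restr_hom[OF G']])
    qed auto
    show "?\<psi> \<oplus>\<^bsub>?H\<^esub> \<phi> = \<zero>\<^bsub>?H\<^esub>"
    proof (rule sheaf_hom_eqI[OF add[OF \<psi> \<phi>] zero])
      fix V s assume V: "openin ?Y V" and s: "s \<in> carrier (sect F V)"
      interpret G: module "\<O> V" "sect G V" by (rule presheaf_module[OF G' V])
      show "(?\<psi> \<oplus>\<^bsub>?H\<^esub> \<phi>) V s = \<zero>\<^bsub>?H\<^esub> V s"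
        using V s by (simp add: hom_sheaf_simps G.l_neg sheaf_hom_closed[OF \<phi>])
    qed
  qed
  have pt: "abelian_group (sect G V)" if "openin ?Y V" for V
    by (rule presheaf_group[OF G' that])
  show ?thesis
  proof (rule abelian_groupI)
    fix \<phi> \<psi>
    assume "\<phi> \<in> carrier ?H" and "\<psi> \<in> carrier ?H"
    then have \<phi>: "\<phi> \<in> sheaf_hom ?Y \<O> F G" and \<psi>: "\<psi> \<in> sheaf_hom ?Y \<O> F G"
      by (simp_all add: hom_sheaf_simps(1))
    show "\<phi> \<oplus>\<^bsub>?H\<^esub> \<psi> \<in> carrier ?H"
      using add[OF \<phi> \<psi>] by (simp add: hom_sheaf_simps(1))
    show "\<phi> \<oplus>\<^bsub>?H\<^esub> \<psi> = \<psi> \<oplus>\<^bsub>?H\<^esub> \<phi>"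
    proof (rule sheaf_hom_eqI[OF add[OF \<phi> \<psi>] add[OF \<psi> \<phi>]])
      fix V s assume V: "openin ?Y V" and s: "s \<in> carrier (sect F V)"
      show "(\<phi> \<oplus>\<^bsub>?H\<^esub> \<psi>) V s = (\<psi> \<oplus>\<^bsub>?H\<^esub> \<phi>) V s"
        using abelian_groupE(4)[OF pt[OF V] sheaf_hom_closed[OF \<phi> V s] sheaf_hom_closed[OF \<psi> V s]]
        by (simp add: hom_sheaf_simps V s)
    qed
    fix \<theta> assume "\<theta> \<in> carrier ?H"
    then have \<theta>: "\<theta> \<in> sheaf_hom ?Y \<O> F G"
      by (simp add: hom_sheaf_simps(1))
    show "\<phi> \<oplus>\<^bsub>?H\<^esub> \<psi> \<oplus>\<^bsub>?H\<^esub> \<theta> = \<phi> \<oplus>\<^bsub>?H\<^esub> (\<psi> \<oplus>\<^bsub>?H\<^esub> \<theta>)"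
    proof (rule sheaf_hom_eqI[OF add[OF add[OF \<phi> \<psi>] \<theta>] add[OF \<phi> add[OF \<psi> \<theta>]]])
      fix V s assume V: "openin ?Y V" and s: "s \<in> carrier (sect F V)"
      show "(\<phi> \<oplus>\<^bsub>?H\<^esub> \<psi> \<oplus>\<^bsub>?H\<^esub> \<theta>) V s = (\<phi> \<oplus>\<^bsub>?H\<^esub> (\<psi> \<oplus>\<^bsub>?H\<^esub> \<theta>)) V s"
        using abelian_groupE(3)[OF pt[OF V] sheaf_hom_closed[OF \<phi> V s] sheaf_hom_closed[OF \<psi> V s]
            sheaf_hom_closed[OF \<theta> V s]]
        by (simp add: hom_sheaf_simps V s)
    qed
  next
    fix \<phi> assume "\<phi> \<in> carrier ?H"
    then have \<phi>: "\<phi> \<in> sheaf_hom ?Y \<O> F G"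
      by (simp add: hom_sheaf_simps(1))
    show "\<zero>\<^bsub>?H\<^esub> \<oplus>\<^bsub>?H\<^esub> \<phi> = \<phi>"
    proof (rule sheaf_hom_eqI[OF add[OF zero \<phi>] \<phi>])
      fix V s assume V: "openin ?Y V" and s: "s \<in> carrier (sect F V)"
      show "(\<zero>\<^bsub>?H\<^esub> \<oplus>\<^bsub>?H\<^esub> \<phi>) V s = \<phi> V s"
        using abelian_groupE(5)[OF pt[OF V] sheaf_hom_closed[OF \<phi> V s]]
        by (simp add: hom_sheaf_simps V s)
    qed
    show "\<exists>\<psi>\<in>carrier ?H. \<psi> \<oplus>\<^bsub>?H\<^esub> \<phi> = \<zero>\<^bsub>?H\<^esub>"
      using neg[OF \<phi>] by (simp only: hom_sheaf_simps(1))
  next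
    show "\<zero>\<^bsub>?H\<^esub> \<in> carrier ?H" using zero by (simp only: hom_sheaf_simps(1))
  qed
qed

lemma hom_postcompose_additive:
  assumes F: "module_presheaf X \<O> F" and G: "module_presheaf X \<O> G" and H: "module_presheaf X \<O> H"
    and d: "d \<in> sheaf_hom X \<O> G H" and U: "openin X U"
  shows "hom_postcompose X F d U \<in>
    hom (add_monoid (sect (hom_sheaf X \<O> F G) U)) (add_monoid (sect (hom_sheaf X \<O> F H) U))"
proof (rule homI)
  let ?Y = "subtopology X U"
  note GH = hom_sheaf_group[OF F G U] hom_sheaf_group[OF F H U]
  note post = hom_postcompose_sheaf_hom[OF F d U]
  fix \<phi> assume "\<phi> \<in> carrier (add_monoid (sect (hom_sheaf X \<O> F G) U))"
  then have \<phi>: "\<phi> \<in> sheaf_hom ?Y \<O> F G" by (simp add: hom_sheaf_simps)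
  show "hom_postcompose X F d U \<phi> \<in> carrier (add_monoid (sect (hom_sheaf X \<O> F H) U))"
    using post[OF \<phi>] by (simp add: hom_sheaf_simps)
  fix \<psi> assume "\<psi> \<in> carrier (add_monoid (sect (hom_sheaf X \<O> F G) U))"
  then have \<psi>: "\<psi> \<in> sheaf_hom ?Y \<O> F G" by (simp add: hom_sheaf_simps)
  have sum: "\<phi> \<oplus>\<^bsub>sect (hom_sheaf X \<O> F G) U\<^esub> \<psi> \<in> sheaf_hom ?Y \<O> F G"
    using abelian_groupE(1)[OF GH(1)] \<phi> \<psi> by (simp add: hom_sheaf_simps)
  have sum': "hom_postcompose X F d U \<phi> \<oplus>\<^bsub>sect (hom_sheaf X \<O> F H) U\<^esub> hom_postcompose X F d U \<psi>
      \<in> sheaf_hom ?Y \<O> F H"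
    using abelian_groupE(1)[OF GH(2)] post[OF \<phi>] post[OF \<psi>] by (simp add: hom_sheaf_simps)
  have "hom_postcompose X F d U (\<phi> \<oplus>\<^bsub>sect (hom_sheaf X \<O> F G) U\<^esub> \<psi>)
     = hom_postcompose X F d U \<phi> \<oplus>\<^bsub>sect (hom_sheaf X \<O> F H) U\<^esub> hom_postcompose X F d U \<psi>"
  proof (rule sheaf_hom_eqI[OF post[OF sum] sum'])
    fix V s assume V: "openin ?Y V" and s: "s \<in> carrier (sect F V)"
    have "openin X V" using V U by (simp add: openin_open_subtopology)
    from linear_maps_add[OF sheaf_hom_linear[OF d this]] V s
    show "hom_postcompose X F d U (\<phi> \<oplus>\<^bsub>sect (hom_sheaf X \<O> F G) U\<^esub> \<psi>) V s =
      (hom_postcompose X F d U \<phi> \<oplus>\<^bsub>sect (hom_sheaf X \<O> F H) U\<^esub> hom_postcompose X F d U \<psi>) V s"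
      by (simp add: hom_sheaf_simps hom_postcompose_apply sheaf_hom_closed[OF \<phi>] sheaf_hom_closed[OF \<psi>])
  qed
  then show "hom_postcompose X F d U (\<phi> \<otimes>\<^bsub>add_monoid (sect (hom_sheaf X \<O> F G) U)\<^esub> \<psi>)
     = hom_postcompose X F d U \<phi> \<otimes>\<^bsub>add_monoid (sect (hom_sheaf X \<O> F H) U)\<^esub> hom_postcompose X F d U \<psi>"
    by simp
qed


section \<open>Restriction of holomorphic functions and of free sheaves\<close>

text \<open>
  Morphisms out of a free sheaf are governed by coefficients, which are sections of \<open>\<O>\<close>; to
  make such a morphism compatible with restriction one must be able to restrict the coefficients
  and the constants \<open>0\<close> and \<open>1\<close> in the basis sections.
\<close>

definition restriction_presheaf :: "'a topology \<Rightarrow> 'a function_sheaf \<Rightarrow> bool" where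
  "restriction_presheaf X \<O> \<longleftrightarrow> (\<forall>U V. openin X U \<and> openin X V \<and> V \<subseteq> U \<longrightarrow>
     (\<lambda>f. restrict f V) \<in> ring_hom (\<O> U) (\<O> V))"

lemma continuous_map_replace_coordinate:
  assumes "z \<in> topspace (complex_space n)" "i < n"
  shows "continuous_map euclidean (complex_space n) (\<lambda>w. z(i := w))"
  unfolding complex_space_def
proof (rule continuous_map_into_subtopology)
  show "continuous_map euclidean (product_topology (\<lambda>_. euclidean) UNIV) (\<lambda>w. z(i := w))"
    by (simp add: continuous_map_componentwise_UNIV)
  show "(\<lambda>w. z(i := w)) \<in> topspace euclidean \<rightarrow> {z. \<forall>i\<ge>n. z i = 0}"
    using assms by (auto simp: complex_space_def)
qed

text \<open>
  Openness of \<open>T\<close> matters: complex differentiability at \<open>z\<close> involves the values of the function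
  at all points near \<open>z\<close> on the coordinate line through \<open>z\<close>, and these must still lie in \<open>T\<close>.
\<close>

lemma holomorphic_n_transform:
  assumes f: "holomorphic_n n S f" and T: "openin (complex_space n) T" "T \<subseteq> S"
    and eq: "\<And>z. z \<in> T \<Longrightarrow> g z = f z"
  shows "holomorphic_n n T g"
  unfolding holomorphic_n_def
proof (intro conjI ballI allI impI)
  have "continuous_map (subtopology (complex_space n) T) euclidean f"
    using f T(2) continuous_map_from_subtopology_mono unfolding holomorphic_n_def by blast
  then show "continuous_map (subtopology (complex_space n) T) euclidean g"
    by (rule continuous_map_eq) (simp add: eq)
  fix z i assume z: "z \<in> T" and i: "i < n"
  have zs: "z \<in> topspace (complex_space n)" using z openin_subset[OF T(1)] by auto
  have "open {w. z(i := w) \<in> T}"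
    using openin_continuous_map_preimage[OF continuous_map_replace_coordinate[OF zs i] T(1)] by simp
  moreover have "z i \<in> {w. z(i := w) \<in> T}" using z by simp
  ultimately obtain e where e: "e > 0" "ball (z i) e \<subseteq> {w. z(i := w) \<in> T}"
    by (meson open_contains_ball)
  have "(\<lambda>w. f (z(i := w))) field_differentiable (at (z i))"
    using f z i T(2) by (auto simp: holomorphic_n_def)
  then show "(\<lambda>w. g (z(i := w))) field_differentiable (at (z i))"
  proof (rule field_differentiable_transform_within[rotated 3])
    fix w assume "dist w (z i) < e"
    then have "w \<in> ball (z i) e" by (simp add: dist_commute)
    then have "z(i := w) \<in> T" using e(2) by auto
    then show "f (z(i := w)) = g (z(i := w))" by (simp add: eq)
  qed (use e in auto)
qed

lemma chart_image_open:
  assumes "is_chart n X c" "openin X W"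
  shows "openin (complex_space n) (snd c ` (W \<inter> fst c))"
proof -
  obtain U \<phi> where c: "c = (U, \<phi>)" by force
  have U: "openin X U" and im: "openin (complex_space n) (\<phi> ` U)"
    and hom: "homeomorphic_map (subtopology X U) (subtopology (complex_space n) (\<phi> ` U)) \<phi>"
    using assms(1) by (auto simp: is_chart_def c)
  have "openin (subtopology X U) (W \<inter> U)"
    using assms(2) by (simp add: openin_subtopology_Int)
  then have "openin (subtopology (complex_space n) (\<phi> ` U)) (\<phi> ` (W \<inter> U))"
    using homeomorphic_imp_open_map[OF hom] by (simp add: open_map_def)
  then show ?thesis using im by (simp add: c openin_open_subtopology)
qed

lemma structure_sheaf_restriction_presheaf:
  assumes "holomorphic_atlas n X A"
  shows "restriction_presheaf X (structure_sheaf n A)"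
  unfolding restriction_presheaf_def
proof (intro allI impI, elim conjE)
  fix U V assume V: "openin X V" and VU: "V \<subseteq> U"
  show "(\<lambda>f. restrict f V) \<in> ring_hom (structure_sheaf n A U) (structure_sheaf n A V)"
  proof (rule ring_hom_memI)
    fix f assume f: "f \<in> carrier (structure_sheaf n A U)"
    have "holomorphic_n n (snd c ` (V \<inter> fst c)) (restrict f V \<circ> inv_into (fst c) (snd c))"
      if c: "c \<in> A" for c
    proof -
      have ch: "is_chart n X c" using assms c by (simp add: holomorphic_atlas_def)
      obtain D \<phi> where D: "c = (D, \<phi>)" by force
      have "homeomorphic_map (subtopology X D) (subtopology (complex_space n) (\<phi> ` D)) \<phi>"
        "D \<subseteq> topspace X"
        using ch openin_subset by (auto simp: is_chart_def D)
      then have inj: "inj_on \<phi> D"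
        using homeomorphic_imp_injective_map by (fastforce simp: Int_absorb1)
      show ?thesis
      proof (rule holomorphic_n_transform)
        show "holomorphic_n n (snd c ` (U \<inter> fst c)) (f \<circ> inv_into (fst c) (snd c))"
          using f c by (simp add: structure_sheaf_def)
        show "openin (complex_space n) (snd c ` (V \<inter> fst c))"
          by (rule chart_image_open[OF ch V])
        show "snd c ` (V \<inter> fst c) \<subseteq> snd c ` (U \<inter> fst c)" using VU by auto
        fix z assume "z \<in> snd c ` (V \<inter> fst c)"
        then show "(restrict f V \<circ> inv_into (fst c) (snd c)) z = (f \<circ> inv_into (fst c) (snd c)) z"
          using inj by (auto simp: D)
      qed
    qed
    then show "restrict f V \<in> carrier (structure_sheaf n A V)"
      by (simp add: structure_sheaf_def)
  qed (use VU in \<open>auto simp: structure_sheaf_def fun_eq_iff\<close>)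
qed

lemma free_sheaf_restr_closed:
  assumes "restriction_presheaf X \<O>" "openin X U" "openin X V" "V \<subseteq> U"
    and "a \<in> carrier (sect (free_sheaf \<O> r) U)"
  shows "restr (free_sheaf \<O> r) U V a \<in> carrier (sect (free_sheaf \<O> r) V)"
proof -
  have "(\<lambda>f. restrict f V) \<in> ring_hom (\<O> U) (\<O> V)"
    using assms(1-4) by (simp add: restriction_presheaf_def)
  then show ?thesis
    using assms(5) by (auto simp: free_sheaf_def PiE_iff dest: ring_hom_closed)
qed

lemma basis_section_restr:
  assumes "restriction_presheaf X \<O>" "openin X U" "openin X V" "V \<subseteq> U" "cring (\<O> U)" "cring (\<O> V)"
  shows "restr (free_sheaf \<O> r) U V (basis_section \<O> r U i) = basis_section \<O> r V i"
proof -
  have h: "(\<lambda>f. restrict f V) \<in> ring_hom (\<O> U) (\<O> V)"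
    using assms(1-4) by (simp add: restriction_presheaf_def)
  have "restrict \<one>\<^bsub>\<O> U\<^esub> V = \<one>\<^bsub>\<O> V\<^esub>" "restrict \<zero>\<^bsub>\<O> U\<^esub> V = \<zero>\<^bsub>\<O> V\<^esub>"
    using ring_hom_one[OF h] ring_hom_zero[OF h cring.axioms(1) cring.axioms(1)] assms(5,6) by simp_all
  then show ?thesis
    by (auto simp: free_sheaf_def basis_section_def fun_eq_iff)
qed

lemma free_sheaf_add_smult_closed:
  assumes "cring (\<O> U)" and "a \<in> carrier (sect (free_sheaf \<O> r) U)"
  shows "b \<in> carrier (sect (free_sheaf \<O> r) U) \<Longrightarrow> a \<oplus>\<^bsub>sect (free_sheaf \<O> r) U\<^esub> b \<in> carrier (sect (free_sheaf \<O> r) U)"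
    and "f \<in> carrier (\<O> U) \<Longrightarrow> f \<odot>\<^bsub>sect (free_sheaf \<O> r) U\<^esub> a \<in> carrier (sect (free_sheaf \<O> r) U)"
proof -
  interpret cring "\<O> U" by fact
  show "b \<in> carrier (sect (free_sheaf \<O> r) U) \<Longrightarrow> a \<oplus>\<^bsub>sect (free_sheaf \<O> r) U\<^esub> b \<in> carrier (sect (free_sheaf \<O> r) U)"
    and "f \<in> carrier (\<O> U) \<Longrightarrow> f \<odot>\<^bsub>sect (free_sheaf \<O> r) U\<^esub> a \<in> carrier (sect (free_sheaf \<O> r) U)"
    using assms(2) by (simp_all add: free_sheaf_def PiE_iff)
qed


section \<open>Local lifting along morphisms out of locally free sheaves\<close>

text \<open>
  Local projectivity of locally free sheaves.  The pointwise hypothesis on \<open>\<phi>\<close> yields a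
  neighbourhood that depends on the lifted section; finiteness of the rank is what gives one
  neighbourhood on which the whole morphism lifts.
\<close>

lemma locally_free_lift:
  fixes E :: "('a, 'e) mod_sheaf" and M :: "('a, 'm) mod_sheaf" and N :: "('a, 'n) mod_sheaf"
  assumes \<O>: "restriction_presheaf X \<O>"
    and lf: "locally_free_finite_rank X \<O> E"
    and M: "module_presheaf X \<O> M" and N: "module_presheaf X \<O> N"
    and d: "d \<in> sheaf_hom X \<O> M N"
    and U: "openin X U" and x: "x \<in> U"
    and \<phi>: "\<phi> \<in> sheaf_hom (subtopology X U) \<O> E N"
    and img: "\<And>V s. openin X V \<Longrightarrow> V \<subseteq> U \<Longrightarrow> s \<in> carrier (sect E V) \<Longrightarrow> \<phi> V s \<in> sheaf_image X M N d V"
  obtains D \<eta> where "openin X D" "x \<in> D" "D \<subseteq> U" "\<eta> \<in> sheaf_hom (subtopology X D) \<O> E M"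
    "\<And>V s. openin X V \<Longrightarrow> V \<subseteq> D \<Longrightarrow> s \<in> carrier (sect E V) \<Longrightarrow> d V (\<eta> V s) = \<phi> V s"
proof -
  have E: "module_presheaf X \<O> E"
    using lf by (simp add: locally_free_finite_rank_def module_sheaf_def)
  have "x \<in> topspace X" using U x openin_subset by auto
  with lf obtain W r \<theta> where W: "openin X W" "x \<in> W"
    and \<theta>: "\<theta> \<in> sheaf_hom (subtopology X W) \<O> (free_sheaf \<O> r) E"
    and iso: "sheaf_iso (subtopology X W) (free_sheaf \<O> r) E \<theta>"
    unfolding locally_free_finite_rank_def by blast
  have subW: "openin (subtopology X W) V \<longleftrightarrow> openin X V \<and> V \<subseteq> W" for V
    using W(1) by (simp add: openin_open_subtopology)
  have subU: "openin (subtopology X U) V \<longleftrightarrow> openin X V \<and> V \<subseteq> U" for V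
    using U by (simp add: openin_open_subtopology)
  have ring: "cring (\<O> V)" if "openin X V" for V
    using presheaf_module[OF E that] by (simp add: module_def)
  let ?L = "free_sheaf \<O> r"
  define B where "B = U \<inter> W"
  have B: "openin X B" "x \<in> B" "B \<subseteq> U" "B \<subseteq> W"
    using U W x by (auto simp: B_def)
  define g where "g i = \<phi> B (\<theta> B (basis_section \<O> r B i))" for i
  have \<theta>e: "\<theta> B (basis_section \<O> r B i) \<in> carrier (sect E B)" for i
    by (rule sheaf_hom_closed[OF \<theta>]) (simp_all add: subW B basis_section_closed ring)
  have gN: "g i \<in> carrier (sect N B)" for i
    unfolding g_def by (rule sheaf_hom_closed[OF \<phi> _ \<theta>e]) (simp add: subU B)
  have "g i \<in> sheaf_image X M N d B" for i
    unfolding g_def by (rule img[OF B(1,3) \<theta>e])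
  then have "\<forall>i. \<exists>V t. openin X V \<and> x \<in> V \<and> V \<subseteq> B \<and> t \<in> carrier (sect M V) \<and> d V t = restr N B V (g i)"
    using B(2) by (fastforce simp: sheaf_image_def)
  then obtain K \<tau> where K: "\<And>i. openin X (K i)" "\<And>i. x \<in> K i" "\<And>i. K i \<subseteq> B"
    and \<tau>: "\<And>i. \<tau> i \<in> carrier (sect M (K i))" and d\<tau>: "\<And>i. d (K i) (\<tau> i) = restr N B (K i) (g i)"
    by metis
  \<comment> \<open>The factor \<open>B\<close> keeps the intersection open and inside \<open>U\<close> even if \<open>r = 0\<close>.\<close>
  define D where "D = B \<inter> \<Inter>(K ` {..<r})"
  have D: "openin X D" "x \<in> D" "D \<subseteq> B" "\<And>i. i < r \<Longrightarrow> D \<subseteq> K i"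
    unfolding D_def using K B by (auto intro!: openin_Int_Inter)
  \<comment> \<open>\<open>t V\<close> prescribes the values of the lift over \<open>V\<close> on the basis, \<open>c V\<close> gives the coordinates of
    a section of \<open>E\<close> in the trivialization \<open>\<theta>\<close>.\<close>
  define t where "t V i = restr M (K i) V (\<tau> i)" for V i
  have tM: "t V i \<in> carrier (sect M V)" if "openin X V" "V \<subseteq> D" "i < r" for V i
    unfolding t_def using that D(4)[OF that(3)] by (intro presheaf_restr_closed[OF M K(1) _ _ \<tau>]) auto
  have t_restr: "restr M V V' (t V i) = t V' i"
    if "openin X V" "openin X V'" "V' \<subseteq> V" "V \<subseteq> D" "i < r" for V V' i
    unfolding t_def using that D(4)[OF that(5)] by (intro presheaf_restr_restr[OF M K(1) _ _ _ _ \<tau>]) auto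
  have dt: "d V (t V i) = restr N B V (g i)" if "openin X V" "V \<subseteq> D" "i < r" for V i
  proof -
    have V: "V \<subseteq> K i" using that D(4) by blast
    have "d V (t V i) = restr N (K i) V (d (K i) (\<tau> i))"
      unfolding t_def by (rule sheaf_hom_natural[OF d K(1) that(1) V \<tau>])
    then show ?thesis
      by (simp add: d\<tau> presheaf_restr_restr[OF N B(1) K(1) that(1) V K(3) gN])
  qed
  define c where "c V = inv_into (carrier (sect ?L V)) (\<theta> V)" for V
  define \<eta> where "\<eta> = (\<lambda>V\<in>{V. openin (subtopology X D) V}. \<lambda>s\<in>carrier (sect E V).
     \<Oplus>\<^bsub>sect M V\<^esub> i\<in>{..<r}. c V s i \<odot>\<^bsub>sect M V\<^esub> t V i)"
  have subD: "openin (subtopology X D) V \<longleftrightarrow> openin X V \<and> V \<subseteq> D" for V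
    using D(1) by (simp add: openin_open_subtopology)
  have \<theta>V: "\<theta> V \<in> linear_maps (\<O> V) (sect ?L V) (sect E V)"
    and bij: "bij_betw (\<theta> V) (carrier (sect ?L V)) (carrier (sect E V))"
    if "openin X V" "V \<subseteq> D" for V
    using sheaf_hom_linear[OF \<theta>, of V] iso that D B by (auto simp: subW sheaf_iso_def)
  have c_linear: "c V \<in> linear_maps (\<O> V) (sect E V) (sect ?L V)" if V: "openin X V" "V \<subseteq> D" for V
    unfolding c_def
    by (rule linear_maps_inverse[OF \<theta>V[OF V] bij[OF V]])
      (simp_all add: free_sheaf_add_smult_closed[where \<O>=\<O> and U=V, OF ring[OF V(1)]])
  have \<theta>c: "\<theta> V (c V s) = s" if "openin X V" "V \<subseteq> D" "s \<in> carrier (sect E V)" for V s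
    unfolding c_def using bij[OF that(1,2)] that(3) by (simp add: bij_betw_inv_into_right)
  have c_closed: "c V s \<in> carrier (sect ?L V)" if "openin X V" "V \<subseteq> D" "s \<in> carrier (sect E V)" for V s
    by (rule linear_maps_closed[OF c_linear[OF that(1,2)] that(3)])
  have coeff: "c V s i \<in> carrier (\<O> V)" if "openin X V" "V \<subseteq> D" "s \<in> carrier (sect E V)" "i < r" for V s i
    using c_closed[OF that(1-3)] that(4) by (auto simp: free_sheaf_def)
  have c_restr: "c V' (restr E V V' s) i = restrict (c V s i) V'"
    if "openin X V" "openin X V'" "V' \<subseteq> V" "V \<subseteq> D" "s \<in> carrier (sect E V)" "i < r" for V V' s i
  proof -
    let ?b = "restr ?L V V' (c V s)"
    have V': "V' \<subseteq> D" "V \<subseteq> W" "V' \<subseteq> W" using that D B by auto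
    have "\<theta> V' ?b = restr E V V' (\<theta> V (c V s))"
      using that V' by (intro sheaf_hom_natural[OF \<theta>]) (auto simp: subW c_closed)
    then have "\<theta> V' ?b = restr E V V' s"
      using that by (simp add: \<theta>c)
    moreover have "?b \<in> carrier (sect ?L V')"
      using that by (intro free_sheaf_restr_closed[OF \<O>] c_closed) auto
    ultimately have "c V' (restr E V V' s) = ?b"
      unfolding c_def using bij_betw_inv_into_left[OF bij[OF that(2) V'(1)]] by metis
    then show ?thesis using that(6) by (simp add: free_sheaf_def)
  qed
  have term_closed: "(\<lambda>i. c V s i \<odot>\<^bsub>sect M V\<^esub> t V i) \<in> {..<r} \<rightarrow> carrier (sect M V)"
    if "openin X V" "V \<subseteq> D" "s \<in> carrier (sect E V)" for V s
    using module.smult_closed[OF presheaf_module[OF M that(1)]] coeff[OF that] tM[OF that(1,2)] by auto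
  have \<eta>: "\<eta> \<in> sheaf_hom (subtopology X D) \<O> E M"
  proof (rule sheaf_homI)
    fix V assume "openin (subtopology X D) V"
    then have V: "openin X V" "V \<subseteq> D" by (simp_all add: subD)
    have "(\<lambda>s. \<Oplus>\<^bsub>sect M V\<^esub> i\<in>{..<r}. c V s i \<odot>\<^bsub>sect M V\<^esub> t V i) \<in> linear_maps (\<O> V) (sect E V) (sect M V)"
      using linear_maps_comp[OF c_linear[OF V] linear_combination_linear[OF presheaf_module[OF M V(1)], of "t V" r \<O> V]]
        tM[OF V] by auto
    from linear_maps_restrict[OF presheaf_module[OF E V(1)] this]
    show "\<eta> V \<in> linear_maps (\<O> V) (sect E V) (sect M V)"
      by (simp add: \<eta>_def subD V)
  next
    fix V V' s assume "openin (subtopology X D) V" "openin (subtopology X D) V'" "V' \<subseteq> V"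
      and s: "s \<in> carrier (sect E V)"
    then have V: "openin X V" "V \<subseteq> D" and V': "openin X V'" "V' \<subseteq> D" and sub: "V' \<subseteq> V"
      by (simp_all add: subD)
    have "restr M V V' (\<eta> V s) = (\<Oplus>\<^bsub>sect M V'\<^esub> i\<in>{..<r}. restr M V V' (c V s i \<odot>\<^bsub>sect M V\<^esub> t V i))"
      using additive_finsum[OF presheaf_group[OF M V(1)] presheaf_group[OF M V'(1)]
          presheaf_restr_hom[OF M V(1) V'(1) sub] _ term_closed[OF V s]] V s
      by (simp add: \<eta>_def subD)
    also have "\<dots> = (\<Oplus>\<^bsub>sect M V'\<^esub> i\<in>{..<r}. c V' (restr E V V' s) i \<odot>\<^bsub>sect M V'\<^esub> t V' i)"
    proof (rule abelian_monoid.finsum_cong')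
      show "abelian_monoid (sect M V')"
        using presheaf_group[OF M V'(1)] by (simp add: abelian_group_def)
      show "(\<lambda>i. c V' (restr E V V' s) i \<odot>\<^bsub>sect M V'\<^esub> t V' i) \<in> {..<r} \<rightarrow> carrier (sect M V')"
        by (rule term_closed[OF V' presheaf_restr_closed[OF E V(1) V'(1) sub s]])
      fix i assume "i \<in> {..<r}"
      then have i: "i < r" by simp
      show "restr M V V' (c V s i \<odot>\<^bsub>sect M V\<^esub> t V i) = c V' (restr E V V' s) i \<odot>\<^bsub>sect M V'\<^esub> t V' i"
        by (simp add: presheaf_restr_smult[OF M V(1) V'(1) sub coeff[OF V s i] tM[OF V i]]
            t_restr[OF V(1) V'(1) sub V(2) i] c_restr[OF V(1) V'(1) sub V(2) s i])
    qed simp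
    also have "\<dots> = \<eta> V' (restr E V V' s)"
      using V' presheaf_restr_closed[OF E V(1) V'(1) sub s] by (simp add: \<eta>_def subD)
    finally show "\<eta> V' (restr E V V' s) = restr M V V' (\<eta> V s)" by simp
  qed (auto simp: \<eta>_def)
  have "d V (\<eta> V s) = \<phi> V s" if V: "openin X V" "V \<subseteq> D" and s: "s \<in> carrier (sect E V)" for V s
  proof -
    have VB: "V \<subseteq> B" and V': "openin (subtopology X U) V" "openin (subtopology X W) V"
      using V D B by (auto simp: subU subW)
    have "d V (\<eta> V s) = (\<Oplus>\<^bsub>sect N V\<^esub> i\<in>{..<r}. d V (c V s i \<odot>\<^bsub>sect M V\<^esub> t V i))"
      using additive_finsum[OF presheaf_group[OF M V(1)] presheaf_group[OF N V(1)]
          sheaf_hom_additive[OF d V(1)] _ term_closed[OF V s]] V s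
      by (simp add: \<eta>_def subD)
    also have "\<dots> = (\<Oplus>\<^bsub>sect N V\<^esub> i\<in>{..<r}. c V s i \<odot>\<^bsub>sect N V\<^esub> \<phi> V (\<theta> V (basis_section \<O> r V i)))"
    proof (rule abelian_monoid.finsum_cong')
      have e: "basis_section \<O> r V i \<in> carrier (sect ?L V)" for i
        by (rule basis_section_closed) (rule ring[OF V(1)])
      have \<theta>e': "\<theta> V (basis_section \<O> r V i) \<in> carrier (sect E V)" for i
        by (rule sheaf_hom_closed[OF \<theta> V'(2) e])
      show "abelian_monoid (sect N V)"
        using presheaf_group[OF N V(1)] by (simp add: abelian_group_def)
      show "(\<lambda>i. c V s i \<odot>\<^bsub>sect N V\<^esub> \<phi> V (\<theta> V (basis_section \<O> r V i))) \<in> {..<r} \<rightarrow> carrier (sect N V)"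
        using module.smult_closed[OF presheaf_module[OF N V(1)]] coeff[OF V s]
          sheaf_hom_closed[OF \<phi> V'(1) \<theta>e'] by auto
      fix i assume "i \<in> {..<r}"
      then have i: "i < r" by simp
      have "\<theta> V (basis_section \<O> r V i) = restr E B V (\<theta> B (basis_section \<O> r B i))"
        unfolding basis_section_restr[where r=r and i=i, OF \<O> B(1) V(1) VB ring[OF B(1)] ring[OF V(1)], symmetric]
        by (rule sheaf_hom_natural[OF \<theta> _ V'(2) VB basis_section_closed[where \<O>=\<O> and U=B, OF ring[OF B(1)]]]) (simp add: subW B)
      then have "\<phi> V (\<theta> V (basis_section \<O> r V i)) = restr N B V (g i)"
        unfolding g_def using sheaf_hom_natural[OF \<phi> _ V'(1) VB \<theta>e] by (simp add: subU B)
      then show "d V (c V s i \<odot>\<^bsub>sect M V\<^esub> t V i) = c V s i \<odot>\<^bsub>sect N V\<^esub> \<phi> V (\<theta> V (basis_section \<O> r V i))"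
        by (simp add: linear_maps_smult[OF sheaf_hom_linear[OF d V(1)] coeff[OF V s i] tM[OF V i]] dt[OF V i])
    qed simp
    also have "\<dots> = \<phi> V (\<theta> V (c V s))"
      by (rule linear_map_eq_combination[where \<O>=\<O> and U=V, OF presheaf_module[OF N V(1)]
          linear_maps_comp[OF sheaf_hom_linear[OF \<theta> V'(2)] sheaf_hom_linear[OF \<phi> V'(1)]]
          c_closed[OF V s], symmetric])
    also have "\<dots> = \<phi> V s" by (simp add: \<theta>c[OF V s])
    finally show ?thesis .
  qed
  with D B \<eta> show thesis by (intro that[of D \<eta>]) auto
qed


section \<open>Vanishing of the sheaf Ext\<close>

lemma hom_coboundaries_subgroup:
  assumes F: "module_presheaf X \<O> F" and C: "\<And>q. module_presheaf X \<O> (I q)"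
    and d: "\<And>q. d q \<in> sheaf_hom X \<O> (I q) (I (Suc q))" and U: "openin X U"
  shows "subgroup (coboundaries (\<lambda>q. hom_sheaf X \<O> F (I q)) (\<lambda>q. hom_postcompose X F (d q)) (Suc j) U)
    (add_monoid (sect (hom_sheaf X \<O> F (I (Suc j))) U))"
proof -
  interpret group_hom "add_monoid (sect (hom_sheaf X \<O> F (I j)) U)"
      "add_monoid (sect (hom_sheaf X \<O> F (I (Suc j))) U)" "hom_postcompose X F (d j) U"
    using hom_postcompose_additive[OF F C C d U] hom_sheaf_group[OF F C U]
    by (simp add: group_hom_def group_hom_axioms_def abelian_group.a_group)
  show ?thesis using img_is_subgroup by (simp add: coboundaries_def)
qed

text \<open>
  The neighbourhood works for all smaller open sets \<open>N\<close> at once, which makes it possible to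
  compare two classes over the intersection of their neighbourhoods.  Restriction to \<open>N\<close> is a
  union over all representatives \<open>\<psi>\<close> of the class; each differs from the lifted cocycle \<open>\<phi>\<close> by a
  coboundary, so each restricts to a coboundary and contributes the zero coset.
\<close>

lemma Ext_class_locally_zero:
  fixes I :: "nat \<Rightarrow> ('a, 'i) mod_sheaf" and E :: "('a, 'e) mod_sheaf"
  assumes \<O>: "restriction_presheaf X \<O>"
    and lf: "locally_free_finite_rank X \<O> E"
    and C: "\<And>q. module_presheaf X \<O> (I q)"
    and d: "\<And>q. d q \<in> sheaf_hom X \<O> (I q) (I (Suc q))"
    and ex: "exact_at X (I j) (d j) (I (Suc j)) (d (Suc j)) (I (Suc (Suc j)))"
    and P: "P = cohomology_presheaf (\<lambda>q. hom_sheaf X \<O> E (I q)) (\<lambda>q. hom_postcompose X E (d q)) (Suc j)"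
    and U: "openin X U" and x: "x \<in> U" and c: "c \<in> carrier (sect P U)"
  obtains W where "openin X W" "x \<in> W" "W \<subseteq> U"
    "\<And>N. openin X N \<Longrightarrow> N \<subseteq> W \<Longrightarrow> restr P U N c =
       coboundaries (\<lambda>q. hom_sheaf X \<O> E (I q)) (\<lambda>q. hom_postcompose X E (d q)) (Suc j) N"
proof -
  let ?C = "\<lambda>q. hom_sheaf X \<O> E (I q)" and ?D = "\<lambda>q. hom_postcompose X E (d q)"
  let ?B = "coboundaries ?C ?D (Suc j)"
  have E: "module_presheaf X \<O> E"
    using lf by (simp add: locally_free_finite_rank_def module_sheaf_def)
  have sub: "openin (subtopology X V) V' \<longleftrightarrow> openin X V' \<and> V' \<subseteq> V" if "openin X V" for V V'
    using that by (simp add: openin_open_subtopology)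
  from c obtain \<phi> where \<phi>_cocycle: "\<phi> \<in> cocycles ?C ?D (Suc j) U"
    and c_eq: "c = (\<lambda>b. b \<oplus>\<^bsub>sect (?C (Suc j)) U\<^esub> \<phi>) ` ?B U"
    by (auto simp: P cohomology_presheaf_def quot_module_def A_RCOSETS_def' a_r_coset_def')
  then have \<phi>: "\<phi> \<in> sheaf_hom (subtopology X U) \<O> E (I (Suc j))"
    and D\<phi>: "?D (Suc j) U \<phi> = \<zero>\<^bsub>sect (?C (Suc (Suc j))) U\<^esub>"
    by (simp_all add: cocycles_def sheaf_kernel_def hom_sheaf_simps)
  have img: "\<phi> V s \<in> sheaf_image X (I j) (I (Suc j)) (d j) V"
    if V: "openin X V" "V \<subseteq> U" and s: "s \<in> carrier (sect E V)" for V s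
  proof -
    have "d (Suc j) V (\<phi> V s) = ?D (Suc j) U \<phi> V s"
      using V s by (simp add: hom_postcompose_apply sub[OF U])
    also have "\<dots> = \<zero>\<^bsub>sect (I (Suc (Suc j))) V\<^esub>"
      using V s by (simp add: D\<phi> hom_sheaf_simps sub[OF U])
    finally have "\<phi> V s \<in> sheaf_kernel (I (Suc j)) (I (Suc (Suc j))) (d (Suc j)) V"
      using sheaf_hom_closed[OF \<phi> _ s] V by (simp add: sheaf_kernel_def sub[OF U])
    then show ?thesis using ex V(1) by (simp add: exact_at_def)
  qed
  obtain W \<eta> where W: "openin X W" "x \<in> W" "W \<subseteq> U"
    and \<eta>: "\<eta> \<in> sheaf_hom (subtopology X W) \<O> E (I j)"
    and lift: "\<And>V s. openin X V \<Longrightarrow> V \<subseteq> W \<Longrightarrow> s \<in> carrier (sect E V) \<Longrightarrow> d j V (\<eta> V s) = \<phi> V s"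
    by (rule locally_free_lift[OF \<O> lf C C d U x \<phi> img]) (assumption | blast)+
  have B_sub: "subgroup (?B V) (add_monoid (sect (?C (Suc j)) V))" if "openin X V" for V
    by (rule hom_coboundaries_subgroup[where X = X and \<O> = \<O> and F = E and I = I and d = d and U = V])
      (rule E C d that)+
  show thesis
  proof (rule that[OF W])
    fix N assume N: "openin X N" "N \<subseteq> W"
    interpret CN: abelian_group "sect (?C (Suc j)) N" by (rule hom_sheaf_group[OF E C N(1)])
    have "restr P U N c = (\<Union>\<psi>\<in>c. ?B N +>\<^bsub>sect (?C (Suc j)) N\<^esub> restrict \<psi> {V. openin (subtopology X N) V})"
      by (simp add: P cohomology_presheaf_def hom_sheaf_simps)
    also have "\<dots> = (\<Union>\<psi>\<in>c. ?B N)"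
    proof (rule SUP_cong[OF refl])
      fix \<psi> assume "\<psi> \<in> c"
      then obtain \<beta> where \<beta>: "\<beta> \<in> sheaf_hom (subtopology X U) \<O> E (I j)"
        and \<psi>: "\<psi> = ?D j U \<beta> \<oplus>\<^bsub>sect (?C (Suc j)) U\<^esub> \<phi>"
        by (auto simp: c_eq coboundaries_def hom_sheaf_simps)
      have NU: "N \<subseteq> U" using N W by blast
      \<comment> \<open>If \<open>\<psi> = d \<beta> + \<phi>\<close> and \<open>\<phi> = d \<eta>\<close>, then \<open>\<psi> = d (\<beta> + \<eta>)\<close> over \<open>N\<close>.\<close>
      let ?r = "\<lambda>\<alpha>. restrict \<alpha> {V. openin (subtopology X N) V}"
      let ?\<gamma> = "?r \<beta> \<oplus>\<^bsub>sect (?C j) N\<^esub> ?r \<eta>"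
      have \<psi>_hom: "\<psi> \<in> sheaf_hom (subtopology X U) \<O> E (I (Suc j))"
        using abelian_groupE(1)[OF hom_sheaf_group[OF E C U]]
          hom_postcompose_sheaf_hom[OF E d U \<beta>] \<phi> by (simp add: \<psi> hom_sheaf_simps)
      have \<gamma>: "?\<gamma> \<in> sheaf_hom (subtopology X N) \<O> E (I j)"
        using abelian_groupE(1)[OF hom_sheaf_group[OF E C N(1)]]
          sheaf_hom_restrict[OF \<beta> U N(1) NU] sheaf_hom_restrict[OF \<eta> W(1) N]
        by (simp add: hom_sheaf_simps)
      have r\<psi>: "?r \<psi> \<in> sheaf_hom (subtopology X N) \<O> E (I (Suc j))"
        by (rule sheaf_hom_restrict[OF \<psi>_hom U N(1) NU])
      have "?r \<psi> = ?D j N ?\<gamma>"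
      proof (rule sheaf_hom_eqI[OF r\<psi> hom_postcompose_sheaf_hom[OF E d N(1) \<gamma>]])
        fix V s assume VN: "openin (subtopology X N) V" and s: "s \<in> carrier (sect E V)"
        then have V: "openin X V" "V \<subseteq> N" by (simp_all add: sub[OF N(1)])
        then have VU: "openin (subtopology X U) V" and VW: "openin (subtopology X W) V" and VW': "V \<subseteq> W"
          using N W by (auto simp: sub[OF U] sub[OF W(1)])
        have "d j V (\<beta> V s \<oplus>\<^bsub>sect (I j) V\<^esub> \<eta> V s) = d j V (\<beta> V s) \<oplus>\<^bsub>sect (I (Suc j)) V\<^esub> d j V (\<eta> V s)"
          by (rule linear_maps_add[OF sheaf_hom_linear[OF d V(1)]
                sheaf_hom_closed[OF \<beta> VU s] sheaf_hom_closed[OF \<eta> VW s]])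
        then show "?r \<psi> V s = ?D j N ?\<gamma> V s"
          by (simp add: \<psi> VN VU s hom_sheaf_simps hom_postcompose_apply lift[OF V(1) VW' s])
      qed
      then have "?r \<psi> \<in> ?B N" using \<gamma> by (auto simp: coboundaries_def hom_sheaf_simps)
      then show "?B N +>\<^bsub>sect (?C (Suc j)) N\<^esub> ?r \<psi> = ?B N"
        using CN.a_coset_join2[OF _ B_sub[OF N(1)]] r\<psi>
        by (simp add: a_r_coset_def hom_sheaf_simps)
    qed
    also have "\<dots> = ?B N"
      using subgroup.one_closed[OF B_sub[OF U]] by (auto simp: c_eq)
    finally show "restr P U N c = ?B N" .
  qed
qed

text \<open>
  If near every point all sections eventually restrict to one and the same family \<open>z\<close>, any two
  sections around \<open>x\<close> have the same germ; a germ being the set of all its representatives, it is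
  then the set of all sections around \<open>x\<close>.
\<close>

lemma germ_eq_if_locally_equal:
  assumes P: "\<And>U c x. openin X U \<Longrightarrow> x \<in> U \<Longrightarrow> c \<in> carrier (sect P U) \<Longrightarrow>
      \<exists>W. openin X W \<and> x \<in> W \<and> W \<subseteq> U \<and> (\<forall>N. openin X N \<and> N \<subseteq> W \<longrightarrow> restr P U N c = z N)"
    and V: "openin X V" "x \<in> V" "s \<in> carrier (sect P V)"
  shows "germ X P x V s = {(W, t). openin X W \<and> x \<in> W \<and> t \<in> carrier (sect P W)}"
proof -
  have "\<exists>N. openin X N \<and> x \<in> N \<and> N \<subseteq> V \<inter> W \<and> restr P V N s = restr P W N t"
    if W: "openin X W" "x \<in> W" "t \<in> carrier (sect P W)" for W t
  proof -
    from P[OF V] obtain V' where V': "openin X V'" "x \<in> V'" "V' \<subseteq> V"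
      "\<And>N. openin X N \<Longrightarrow> N \<subseteq> V' \<Longrightarrow> restr P V N s = z N" by blast
    from P[OF W] obtain W' where W': "openin X W'" "x \<in> W'" "W' \<subseteq> W"
      "\<And>N. openin X N \<Longrightarrow> N \<subseteq> W' \<Longrightarrow> restr P W N t = z N" by blast
    show ?thesis
    proof (intro exI[of _ "V' \<inter> W'"] conjI)
      have N: "openin X (V' \<inter> W')" using V' W' by auto
      then show "restr P V (V' \<inter> W') s = restr P W (V' \<inter> W') t"
        using V'(4)[OF N] W'(4)[OF N] by simp
    qed (use V' W' in auto)
  qed
  then show ?thesis by (auto simp: germ_def)
qed

lemma sheafify_subsingleton:
  assumes P: "\<And>U c x. openin X U \<Longrightarrow> x \<in> U \<Longrightarrow> c \<in> carrier (sect P U) \<Longrightarrow>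
      \<exists>W. openin X W \<and> x \<in> W \<and> W \<subseteq> U \<and> (\<forall>N. openin X N \<and> N \<subseteq> W \<longrightarrow> restr P U N c = z N)"
    and s: "s \<in> carrier (sect (sheafify X P) U)" and s': "s' \<in> carrier (sect (sheafify X P) U)"
  shows "s = s'"
proof -
  have val: "s x = {(W, t). openin X W \<and> x \<in> W \<and> t \<in> carrier (sect P W)}"
    if s: "s \<in> carrier (sect (sheafify X P) U)" and x: "x \<in> U" for s x
  proof -
    from s x obtain V t where "openin X V" "x \<in> V" "t \<in> carrier (sect P V)" "s x = germ X P x V t"
      by (fastforce simp: sheafify_def)
    then show ?thesis using germ_eq_if_locally_equal[OF P] by simp
  qed
  have "s \<in> extensional U" "s' \<in> extensional U"
    using s s' by (auto simp: sheafify_def)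
  then show ?thesis
    by (rule extensionalityI) (simp add: val[OF s] val[OF s'])
qed

lemma sheaf_Ext_subsingleton:
  assumes \<O>: "restriction_presheaf X \<O>"
    and lf: "locally_free_finite_rank X \<O> E"
    and res: "injective_resolution X \<O> G I d \<epsilon>" and k: "k > 0"
    and s: "s \<in> carrier (sect (sheaf_Ext X \<O> E I d k) U)" "s' \<in> carrier (sect (sheaf_Ext X \<O> E I d k) U)"
  shows "s = s'"
proof -
  obtain j where j: "k = Suc j" using k gr0_implies_Suc by blast
  have C: "module_presheaf X \<O> (I q)" and d: "d q \<in> sheaf_hom X \<O> (I q) (I (Suc q))"
    and ex: "exact_at X (I q) (d q) (I (Suc q)) (d (Suc q)) (I (Suc (Suc q)))" for q
    using res by (simp_all add: injective_resolution_def injective_sheaf_def module_sheaf_def)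
  let ?C = "\<lambda>q. hom_sheaf X \<O> E (I q)" and ?D = "\<lambda>q. hom_postcompose X E (d q)"
  show ?thesis
  proof (rule sheafify_subsingleton[where P = "cohomology_presheaf ?C ?D k" and z = "coboundaries ?C ?D k"])
    fix U c x assume "openin X U" "x \<in> U" "c \<in> carrier (sect (cohomology_presheaf ?C ?D k) U)"
    note c = this[unfolded j]
    show "\<exists>W. openin X W \<and> x \<in> W \<and> W \<subseteq> U \<and>
        (\<forall>N. openin X N \<and> N \<subseteq> W \<longrightarrow> restr (cohomology_presheaf ?C ?D k) U N c = coboundaries ?C ?D k N)"
      unfolding j by (rule Ext_class_locally_zero[OF \<O> lf C d ex refl c]) blast
  qed (use s in \<open>simp_all add: sheaf_Ext_def cohomology_sheaf_def\<close>)
qed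


section \<open>Injective resolutions of a zero sheaf\<close>

lemma kernel_sheaf_simps:
  "sect (kernel_sheaf F G \<phi>) U = (sect F U)\<lparr>carrier := sheaf_kernel F G \<phi> U\<rparr>"
  "restr (kernel_sheaf F G \<phi>) = restr F"
  by (simp_all add: kernel_sheaf_def)

lemma sheaf_kernel_submodule:
  assumes F: "module_presheaf X \<O> F" and G: "module_presheaf X \<O> G"
    and \<phi>: "\<phi> \<in> sheaf_hom X \<O> F G" and U: "openin X U"
  shows "submodule (sheaf_kernel F G \<phi> U) (\<O> U) (sect F U)"
proof -
  interpret F: module "\<O> U" "sect F U" by (rule presheaf_module[OF F U])
  interpret G: module "\<O> U" "sect G U" by (rule presheaf_module[OF G U])
  note lin = sheaf_hom_linear[OF \<phi> U] and add = sheaf_hom_additive[OF \<phi> U]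
  note grp = F.abelian_group_axioms G.abelian_group_axioms
  show ?thesis
    by (rule F.submoduleI)
      (simp_all add: sheaf_kernel_def subset_iff linear_maps_add[OF lin] linear_maps_smult[OF lin]
        additive_zero[OF grp add] additive_a_inv[OF grp add])
qed

lemma kernel_sheaf_is_sheaf:
  assumes F: "module_sheaf X \<O> F" and G: "module_sheaf X \<O> G" and \<phi>: "\<phi> \<in> sheaf_hom X \<O> F G"
  shows "module_sheaf X \<O> (kernel_sheaf F G \<phi>)"
proof -
  note F' = module_sheaf_presheaf[OF F] and G' = module_sheaf_presheaf[OF G]
  let ?K = "kernel_sheaf F G \<phi>"
  have K: "s \<in> carrier (sect ?K U) \<longleftrightarrow> s \<in> carrier (sect F U) \<and> \<phi> U s = \<zero>\<^bsub>sect G U\<^esub>" for s U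
    by (simp add: kernel_sheaf_simps sheaf_kernel_def)
  have restr_closed: "restr F U V s \<in> carrier (sect ?K V)"
    if "openin X U" "openin X V" "V \<subseteq> U" "s \<in> carrier (sect ?K U)" for U V s
    using that by (simp add: K presheaf_restr_closed[OF F'] sheaf_hom_natural[OF \<phi>] presheaf_restr_zero[OF G'])
  have "module_presheaf X \<O> ?K"
    unfolding module_presheaf_def
  proof (intro conjI allI impI ballI; (elim conjE)?)
    fix U assume U: "openin X U"
    show "module (\<O> U) (sect ?K U)"
      using submodule.submodule_is_module[OF sheaf_kernel_submodule[OF F' G' \<phi> U] presheaf_module[OF F' U]]
      by (simp add: kernel_sheaf_simps)
    fix s assume "s \<in> carrier (sect ?K U)"
    then show "restr ?K U U s = s" using U by (simp add: K kernel_sheaf_simps(2) presheaf_restr_id[OF F'])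
  next
    fix U V assume UV: "openin X U" "openin X V" "V \<subseteq> U"
    show "restr ?K U V \<in> hom (add_monoid (sect ?K U)) (add_monoid (sect ?K V))"
      using restr_closed[OF UV] presheaf_restr_add[OF F' UV]
      by (intro homI) (simp_all add: kernel_sheaf_simps sheaf_kernel_def)
    fix f s assume "f \<in> carrier (\<O> U)" "s \<in> carrier (sect ?K U)"
    then show "restr ?K U V (f \<odot>\<^bsub>sect ?K U\<^esub> s) = restrict f V \<odot>\<^bsub>sect ?K V\<^esub> restr ?K U V s"
      using UV by (simp add: kernel_sheaf_simps sheaf_kernel_def presheaf_restr_smult[OF F'])
  next
    fix U V W s assume "openin X U" "openin X V" "openin X W" "W \<subseteq> V" "V \<subseteq> U" "s \<in> carrier (sect ?K U)"
    then show "restr ?K V W (restr ?K U V s) = restr ?K U W s"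
      by (simp add: K kernel_sheaf_simps(2) presheaf_restr_restr[OF F'])
  qed
  moreover have "s = t" if op: "\<forall>V\<in>\<U>. openin X V"
    and s: "s \<in> carrier (sect ?K (\<Union>\<U>))" and t: "t \<in> carrier (sect ?K (\<Union>\<U>))"
    and eq: "\<forall>V\<in>\<U>. restr ?K (\<Union>\<U>) V s = restr ?K (\<Union>\<U>) V t" for \<U> s t
  proof (rule sheaf_eqI_local[OF F, of "\<Union>\<U>"])
    fix x assume "x \<in> \<Union>\<U>"
    then show "\<exists>V. openin X V \<and> x \<in> V \<and> V \<subseteq> \<Union>\<U> \<and> restr F (\<Union>\<U>) V s = restr F (\<Union>\<U>) V t"
      using op eq by (auto simp: kernel_sheaf_simps(2))
  qed (use op s t K in auto)
  moreover have "\<exists>t\<in>carrier (sect ?K (\<Union>\<U>)). \<forall>V\<in>\<U>. restr ?K (\<Union>\<U>) V t = s V"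
    if op: "\<forall>V\<in>\<U>. openin X V" and s: "\<forall>V\<in>\<U>. s V \<in> carrier (sect ?K V)"
      and eq: "\<forall>V\<in>\<U>. \<forall>W\<in>\<U>. restr ?K V (V \<inter> W) (s V) = restr ?K W (V \<inter> W) (s W)" for \<U> s
  proof -
    have op': "openin X V" and s': "s V \<in> carrier (sect F V)" if "V \<in> \<U>" for V
      using op s that by (auto simp: K)
    have eq': "restr F V (V \<inter> W) (s V) = restr F W (V \<inter> W) (s W)" if "V \<in> \<U>" "W \<in> \<U>" for V W
      using eq that unfolding kernel_sheaf_simps(2) by blast
    obtain t where t: "t \<in> carrier (sect F (\<Union>\<U>))" "\<And>V. V \<in> \<U> \<Longrightarrow> restr F (\<Union>\<U>) V t = s V"
      by (rule sheaf_glue[OF F, of \<U> s]) (erule op' | erule s' | erule (1) eq' | blast)+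
    have un: "openin X (\<Union>\<U>)" using op by auto
    have "\<phi> (\<Union>\<U>) t = \<zero>\<^bsub>sect G (\<Union>\<U>)\<^esub>"
    proof (rule sheaf_eqI_local[OF G un])
      show "\<phi> (\<Union>\<U>) t \<in> carrier (sect G (\<Union>\<U>))" by (rule sheaf_hom_closed[OF \<phi> un t(1)])
      show "\<zero>\<^bsub>sect G (\<Union>\<U>)\<^esub> \<in> carrier (sect G (\<Union>\<U>))"
        by (rule abelian_groupE(2)[OF presheaf_group[OF G' un]])
      fix x assume "x \<in> \<Union>\<U>"
      then obtain V where V: "V \<in> \<U>" "x \<in> V" by blast
      have VU: "V \<subseteq> \<Union>\<U>" and V': "openin X V" using V op by auto
      have "restr G (\<Union>\<U>) V (\<phi> (\<Union>\<U>) t) = \<phi> V (restr F (\<Union>\<U>) V t)"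
        by (rule sheaf_hom_natural[OF \<phi> un V' VU t(1), symmetric])
      also have "\<dots> = \<zero>\<^bsub>sect G V\<^esub>" using s V by (simp add: t(2) K)
      also have "\<dots> = restr G (\<Union>\<U>) V \<zero>\<^bsub>sect G (\<Union>\<U>)\<^esub>"
        by (rule presheaf_restr_zero[OF G' un V' VU, symmetric])
      finally show "\<exists>V. openin X V \<and> x \<in> V \<and> V \<subseteq> \<Union>\<U> \<and>
          restr G (\<Union>\<U>) V (\<phi> (\<Union>\<U>) t) = restr G (\<Union>\<U>) V \<zero>\<^bsub>sect G (\<Union>\<U>)\<^esub>"
        using V V' VU by auto
    qed
    then show ?thesis using t by (intro bexI[of _ t]) (simp_all add: K kernel_sheaf_simps(2))
  qed
  ultimately show ?thesis unfolding module_sheaf_def by (intro conjI allI impI ballI) (simp | blast)+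
qed

lemma identity_sheaf_hom:
  assumes "module_presheaf X \<O> F"
  shows "(\<lambda>U\<in>{U. openin X U}. \<lambda>s\<in>carrier (sect F U). s) \<in> sheaf_hom X \<O> F F"
proof (rule sheaf_homI)
  fix U assume U: "openin X U"
  have "(\<lambda>s. s) \<in> linear_maps (\<O> U) (sect F U) (sect F U)" by (rule linear_mapsI) simp_all
  then show "(\<lambda>U\<in>{U. openin X U}. \<lambda>s\<in>carrier (sect F U). s) U \<in> linear_maps (\<O> U) (sect F U) (sect F U)"
    using linear_maps_restrict[OF presheaf_module[OF assms U], of "\<lambda>s. s" "sect F U"] U by simp
qed (use presheaf_restr_closed[OF assms] in auto)

lemma sheaf_hom_restrict_kernel:
  assumes F: "module_sheaf X \<O> F" and G: "module_sheaf X \<O> G" and \<phi>: "\<phi> \<in> sheaf_hom X \<O> F G"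
    and \<psi>: "\<psi> \<in> sheaf_hom X \<O> F H"
  shows "(\<lambda>U\<in>{U. openin X U}. restrict (\<psi> U) (carrier (sect (kernel_sheaf F G \<phi>) U)))
    \<in> sheaf_hom X \<O> (kernel_sheaf F G \<phi>) H"
proof (rule sheaf_homI)
  let ?K = "kernel_sheaf F G \<phi>"
  note K = module_sheaf_presheaf[OF kernel_sheaf_is_sheaf[OF F G \<phi>]]
  fix U assume U: "openin X U"
  note lin = sheaf_hom_linear[OF \<psi> U]
  have "\<psi> U \<in> linear_maps (\<O> U) (sect ?K U) (sect H U)"
    by (rule linear_mapsI) (simp_all add: kernel_sheaf_simps sheaf_kernel_def linear_mapsD[OF lin])
  then show "(\<lambda>U\<in>{U. openin X U}. restrict (\<psi> U) (carrier (sect ?K U))) U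
      \<in> linear_maps (\<O> U) (sect ?K U) (sect H U)"
    using linear_maps_restrict[OF presheaf_module[OF K U]] U by simp
next
  let ?K = "kernel_sheaf F G \<phi>"
  note K = module_sheaf_presheaf[OF kernel_sheaf_is_sheaf[OF F G \<phi>]]
  fix U V s assume UV: "openin X U" "openin X V" "V \<subseteq> U" and s: "s \<in> carrier (sect ?K U)"
  have "restr ?K U V s \<in> carrier (sect ?K V)" by (rule presheaf_restr_closed[OF K UV s])
  moreover have "\<psi> V (restr F U V s) = restr H U V (\<psi> U s)"
    by (rule sheaf_hom_natural[OF \<psi> UV]) (use s in \<open>simp add: kernel_sheaf_simps sheaf_kernel_def\<close>)
  ultimately show "(\<lambda>U\<in>{U. openin X U}. restrict (\<psi> U) (carrier (sect ?K U))) V (restr ?K U V s)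
     = restr H U V ((\<lambda>U\<in>{U. openin X U}. restrict (\<psi> U) (carrier (sect ?K U))) U s)"
    using UV s by (simp add: kernel_sheaf_simps(2))
qed auto

lemma section_image_in_sheaf_image:
  assumes "module_presheaf X \<O> G" "openin X U" "t \<in> carrier (sect F U)" "\<phi> U t \<in> carrier (sect G U)"
  shows "\<phi> U t \<in> sheaf_image X F G \<phi> U"
  unfolding sheaf_image_def
proof (intro CollectI conjI ballI exI[of _ U] bexI[of _ t])
  show "\<phi> U t = restr G U U (\<phi> U t)"
    using presheaf_restr_id[OF assms(1,2,4)] by simp
qed (use assms in auto)

text \<open>
  Applied to consecutive terms of an exact complex, this carries a projection \<open>\<pi>\<close> onto the
  kernel of \<open>d\<close> to a projection \<open>\<pi>'\<close> onto the kernel of \<open>d'\<close>.  On the complement of the kernel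
  of \<open>d\<close>, which is the kernel of \<open>\<pi>\<close>, \<open>d\<close> has a left inverse \<open>\<psi>\<close> because \<open>M\<close> is injective, and
  \<open>\<pi>' = d \<circ> \<psi>\<close>.  The gain over exactness of sheaves is that the values of \<open>\<pi>'\<close> have preimages
  under \<open>d\<close> over all of \<open>U\<close>.
\<close>

lemma kernel_projection_step:
  fixes M N P :: "('a, 'm) mod_sheaf"
  assumes M: "injective_sheaf X \<O> M" and N: "module_sheaf X \<O> N" and P: "module_sheaf X \<O> P"
    and d: "d \<in> sheaf_hom X \<O> M N" and d': "d' \<in> sheaf_hom X \<O> N P"
    and ex: "exact_at X M d N d' P"
    and \<pi>: "\<pi> \<in> sheaf_hom X \<O> M M"
    and d\<pi>: "\<And>U s. openin X U \<Longrightarrow> s \<in> carrier (sect M U) \<Longrightarrow> d U (\<pi> U s) = \<zero>\<^bsub>sect N U\<^esub>"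
    and ker_fix: "\<And>U s. openin X U \<Longrightarrow> s \<in> carrier (sect M U) \<Longrightarrow> d U s = \<zero>\<^bsub>sect N U\<^esub> \<Longrightarrow> \<pi> U s = s"
  obtains \<pi>' where "\<pi>' \<in> sheaf_hom X \<O> N N"
    "\<And>U s. openin X U \<Longrightarrow> s \<in> carrier (sect N U) \<Longrightarrow> \<pi>' U s \<in> d U ` carrier (sect M U)"
    "\<And>U s. openin X U \<Longrightarrow> s \<in> carrier (sect N U) \<Longrightarrow> d' U (\<pi>' U s) = \<zero>\<^bsub>sect P U\<^esub>"
    "\<And>U s. openin X U \<Longrightarrow> s \<in> carrier (sect N U) \<Longrightarrow> d' U s = \<zero>\<^bsub>sect P U\<^esub> \<Longrightarrow> \<pi>' U s = s"
proof -
  have Ms: "module_sheaf X \<O> M" using M by (simp add: injective_sheaf_def)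
  note M' = module_sheaf_presheaf[OF Ms] and N' = module_sheaf_presheaf[OF N]
  let ?K = "kernel_sheaf M M \<pi>"
  have K: "module_sheaf X \<O> ?K" by (rule kernel_sheaf_is_sheaf[OF Ms Ms \<pi>])
  have Kc: "s \<in> carrier (sect ?K U) \<longleftrightarrow> s \<in> carrier (sect M U) \<and> \<pi> U s = \<zero>\<^bsub>sect M U\<^esub>" for s U
    by (simp add: kernel_sheaf_simps sheaf_kernel_def)
  define \<iota> where "\<iota> = (\<lambda>U\<in>{U. openin X U}. restrict (d U) (carrier (sect ?K U)))"
  have \<iota>: "\<iota> \<in> sheaf_hom X \<O> ?K N"
    unfolding \<iota>_def by (rule sheaf_hom_restrict_kernel[OF Ms Ms \<pi> d])
  define i where "i = (\<lambda>U\<in>{U. openin X U}. \<lambda>s\<in>carrier (sect M U). s)"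
  have i: "i \<in> sheaf_hom X \<O> M M" unfolding i_def by (rule identity_sheaf_hom[OF M'])
  define j where "j = (\<lambda>U\<in>{U. openin X U}. restrict (i U) (carrier (sect ?K U)))"
  have j: "j \<in> sheaf_hom X \<O> ?K M"
    unfolding j_def by (rule sheaf_hom_restrict_kernel[OF Ms Ms \<pi> i])
  have j_eq: "j U s = s" if "openin X U" "s \<in> carrier (sect ?K U)" for U s
    using that by (simp add: j_def i_def Kc)
  \<comment> \<open>A difference of sections with equal image lies in the kernel of \<open>d\<close>, hence is fixed by \<open>\<pi>\<close>,
    and is annihilated by \<open>\<pi>\<close>.\<close>
  have mono: "sheaf_mono X ?K \<iota>"
    unfolding sheaf_mono_def
  proof (intro allI impI inj_onI)
    fix U s t assume U: "openin X U" and st: "s \<in> carrier (sect ?K U)" "t \<in> carrier (sect ?K U)"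
      and eq: "\<iota> U s = \<iota> U t"
    interpret M: abelian_group "sect M U" by (rule presheaf_group[OF M' U])
    interpret N: abelian_group "sect N U" by (rule presheaf_group[OF N' U])
    have s: "s \<in> carrier (sect M U)" "\<pi> U s = \<zero>\<^bsub>sect M U\<^esub>" and t: "t \<in> carrier (sect M U)" "\<pi> U t = \<zero>\<^bsub>sect M U\<^esub>"
      using st by (simp_all add: Kc)
    have "d U s = d U t" using eq st U by (simp add: \<iota>_def)
    then have "d U (s \<oplus>\<^bsub>sect M U\<^esub> \<ominus>\<^bsub>sect M U\<^esub> t) = \<zero>\<^bsub>sect N U\<^esub>"
      using s t linear_mapsD[OF sheaf_hom_linear[OF d U]]
        additive_a_inv[OF M.abelian_group_axioms N.abelian_group_axioms sheaf_hom_additive[OF d U]]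
      by (simp add: N.r_neg)
    then have "\<pi> U (s \<oplus>\<^bsub>sect M U\<^esub> \<ominus>\<^bsub>sect M U\<^esub> t) = s \<oplus>\<^bsub>sect M U\<^esub> \<ominus>\<^bsub>sect M U\<^esub> t"
      using s t by (intro ker_fix[OF U]) auto
    moreover have "\<pi> U (s \<oplus>\<^bsub>sect M U\<^esub> \<ominus>\<^bsub>sect M U\<^esub> t) = \<zero>\<^bsub>sect M U\<^esub>"
      using s t linear_mapsD[OF sheaf_hom_linear[OF \<pi> U]]
        additive_a_inv[OF M.abelian_group_axioms M.abelian_group_axioms sheaf_hom_additive[OF \<pi> U]]
      by simp
    ultimately have "s \<oplus>\<^bsub>sect M U\<^esub> \<ominus>\<^bsub>sect M U\<^esub> t = \<zero>\<^bsub>sect M U\<^esub>" by simp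
    then show "s = t" using s t M.minus_equality M.minus_minus M.a_inv_closed by metis
  qed
  have "\<exists>\<psi>\<in>sheaf_hom X \<O> N M. \<forall>U. openin X U \<longrightarrow> (\<forall>s\<in>carrier (sect ?K U). \<psi> U (\<iota> U s) = j U s)"
    using M K N \<iota> j mono unfolding injective_sheaf_def by blast
  then obtain \<psi> where \<psi>: "\<psi> \<in> sheaf_hom X \<O> N M"
    and "\<And>U s. openin X U \<Longrightarrow> s \<in> carrier (sect ?K U) \<Longrightarrow> \<psi> U (\<iota> U s) = j U s"
    by blast
  then have \<psi>d: "\<psi> U (d U s) = s" if "openin X U" "s \<in> carrier (sect ?K U)" for U s
    using that by (simp add: j_eq \<iota>_def)
  define \<pi>' where "\<pi>' = hom_postcompose X N d (topspace X) \<psi>"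
  have \<pi>': "\<pi>' \<in> sheaf_hom X \<O> N N"
    unfolding \<pi>'_def using hom_postcompose_sheaf_hom[OF N' d, of "topspace X" \<psi>] \<psi> by simp
  have \<pi>'_eq: "\<pi>' U s = d U (\<psi> U s)" if "openin X U" "s \<in> carrier (sect N U)" for U s
    unfolding \<pi>'_def using that by (simp add: hom_postcompose_apply)
  have d'd: "d' U (d U t) = \<zero>\<^bsub>sect P U\<^esub>" if U: "openin X U" and t: "t \<in> carrier (sect M U)" for U t
  proof -
    have dt: "d U t \<in> carrier (sect N U)" by (rule sheaf_hom_closed[OF d U t])
    have "d U t \<in> sheaf_image X M N d U"
      by (rule section_image_in_sheaf_image[where F = M and \<phi> = d, OF N' U t dt])
    then show ?thesis using ex U by (simp add: exact_at_def sheaf_kernel_def)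
  qed
  have ker_fix': "\<pi>' U s = s" if U: "openin X U" and s: "s \<in> carrier (sect N U)"
    and ds: "d' U s = \<zero>\<^bsub>sect P U\<^esub>" for U s
  proof (rule sheaf_eqI_local[OF N U])
    show "\<pi>' U s \<in> carrier (sect N U)" by (rule sheaf_hom_closed[OF \<pi>' U s])
    show "s \<in> carrier (sect N U)" by (rule s)
    fix x assume x: "x \<in> U"
    have "s \<in> sheaf_image X M N d U"
      using ex U s ds by (simp add: exact_at_def sheaf_kernel_def)
    then obtain V t where V: "openin X V" "x \<in> V" "V \<subseteq> U" and t: "t \<in> carrier (sect M V)"
      and dt: "d V t = restr N U V s"
      using x by (auto simp: sheaf_image_def)
    interpret M: abelian_group "sect M V" by (rule presheaf_group[OF M' V(1)])
    interpret N: abelian_group "sect N V" by (rule presheaf_group[OF N' V(1)])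
    \<comment> \<open>The map \<open>\<psi>\<close> inverts \<open>d\<close> only on the kernel of \<open>\<pi>\<close>; subtracting \<open>\<pi> t\<close> moves the local
      preimage there without changing its image.\<close>
    let ?t = "t \<oplus>\<^bsub>sect M V\<^esub> \<ominus>\<^bsub>sect M V\<^esub> \<pi> V t"
    note lin\<pi> = sheaf_hom_linear[OF \<pi> V(1)] and lind = sheaf_hom_linear[OF d V(1)]
    have \<pi>t: "\<pi> V t \<in> carrier (sect M V)" by (rule sheaf_hom_closed[OF \<pi> V(1) t])
    have "\<pi> V (\<pi> V t) = \<pi> V t" by (rule ker_fix[OF V(1) \<pi>t d\<pi>[OF V(1) t]])
    then have "\<pi> V ?t = \<zero>\<^bsub>sect M V\<^esub>"
      using t \<pi>t linear_mapsD[OF lin\<pi>]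
        additive_a_inv[OF M.abelian_group_axioms M.abelian_group_axioms sheaf_hom_additive[OF \<pi> V(1)]]
      by (simp add: M.r_neg)
    then have Kt: "?t \<in> carrier (sect ?K V)" using t \<pi>t by (simp add: Kc)
    have dt': "d V ?t = d V t"
      using t \<pi>t d\<pi>[OF V(1) t] linear_mapsD[OF lind]
        additive_a_inv[OF M.abelian_group_axioms N.abelian_group_axioms sheaf_hom_additive[OF d V(1)]]
      by simp
    have rs: "restr N U V s \<in> carrier (sect N V)" by (rule presheaf_restr_closed[OF N' U V(1,3) s])
    have "restr N U V (\<pi>' U s) = \<pi>' V (restr N U V s)"
      by (rule sheaf_hom_natural[OF \<pi>' U V(1,3) s, symmetric])
    also have "\<dots> = d V (\<psi> V (d V ?t))" by (simp only: \<pi>'_eq[OF V(1) rs] dt' dt)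
    also have "\<dots> = d V ?t" by (simp only: \<psi>d[OF V(1) Kt])
    also have "\<dots> = restr N U V s" by (simp only: dt' dt)
    finally show "\<exists>V. openin X V \<and> x \<in> V \<and> V \<subseteq> U \<and> restr N U V (\<pi>' U s) = restr N U V s"
      using V by blast
  qed
  show thesis
  proof (rule that[OF \<pi>'])
    fix U s assume Us: "openin X U" "s \<in> carrier (sect N U)"
    then show "\<pi>' U s \<in> d U ` carrier (sect M U)" "d' U (\<pi>' U s) = \<zero>\<^bsub>sect P U\<^esub>"
      by (simp_all add: \<pi>'_eq d'd sheaf_hom_closed[OF \<psi>])
    show "\<pi>' U s = s" if "d' U s = \<zero>\<^bsub>sect P U\<^esub>" by (rule ker_fix'[OF Us that])
  qed
qed

text \<open>
  The projections \<open>proj q\<close> onto the kernels of the differentials start with the zero morphism,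
  since the first differential is injective when the resolved sheaf vanishes.
\<close>

lemma resolution_of_zero_exact_on_sections:
  fixes I :: "nat \<Rightarrow> ('a, 'm) mod_sheaf"
  assumes res: "injective_resolution X \<O> F I d \<epsilon>"
    and zero: "\<And>U s s'. openin X U \<Longrightarrow> s \<in> carrier (sect F U) \<Longrightarrow> s' \<in> carrier (sect F U) \<Longrightarrow> s = s'"
    and U: "openin X U"
  shows "cocycles I d q U = coboundaries I d q U"
proof -
  have Fs: "module_sheaf X \<O> F" and inj: "injective_sheaf X \<O> (I q)" and Is: "module_sheaf X \<O> (I q)"
    and d: "d q \<in> sheaf_hom X \<O> (I q) (I (Suc q))"
    and ex: "exact_at X (I q) (d q) (I (Suc q)) (d (Suc q)) (I (Suc (Suc q)))"
    and \<epsilon>: "\<epsilon> \<in> sheaf_hom X \<O> F (I 0)" and ex0: "exact_at X F \<epsilon> (I 0) (d 0) (I 1)" for q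
    using res by (simp_all add: injective_resolution_def injective_sheaf_def)
  note I' = module_sheaf_presheaf[OF Is] and F' = module_sheaf_presheaf[OF Fs]
  have inj0: "s = \<zero>\<^bsub>sect (I 0) U\<^esub>"
    if U: "openin X U" and s: "s \<in> carrier (sect (I 0) U)" and ds: "d 0 U s = \<zero>\<^bsub>sect (I 1) U\<^esub>" for U s
  proof (rule sheaf_eqI_local[OF Is U s])
    show "\<zero>\<^bsub>sect (I 0) U\<^esub> \<in> carrier (sect (I 0) U)"
      by (rule abelian_groupE(2)[OF presheaf_group[OF I' U]])
    fix x assume x: "x \<in> U"
    have "s \<in> sheaf_image X F (I 0) \<epsilon> U"
      using ex0 U s ds by (simp add: exact_at_def sheaf_kernel_def)
    then obtain V t where V: "openin X V" "x \<in> V" "V \<subseteq> U" and t: "t \<in> carrier (sect F V)"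
      and \<epsilon>t: "\<epsilon> V t = restr (I 0) U V s"
      using x by (auto simp: sheaf_image_def)
    have "t = \<zero>\<^bsub>sect F V\<^esub>"
      by (rule zero[OF V(1) t abelian_groupE(2)[OF presheaf_group[OF F' V(1)]]])
    then have "restr (I 0) U V s = \<zero>\<^bsub>sect (I 0) V\<^esub>"
      using \<epsilon>t additive_zero[OF presheaf_group[OF F' V(1)] presheaf_group[OF I' V(1)]
          sheaf_hom_additive[OF \<epsilon> V(1)]] by simp
    then show "\<exists>V. openin X V \<and> x \<in> V \<and> V \<subseteq> U \<and> restr (I 0) U V s = restr (I 0) U V \<zero>\<^bsub>sect (I 0) U\<^esub>"
      using V presheaf_restr_zero[OF I' U V(1,3)] by auto
  qed
  define proj where "proj q \<pi> \<longleftrightarrow> \<pi> \<in> sheaf_hom X \<O> (I q) (I q) \<and>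
      (\<forall>U s. openin X U \<and> s \<in> carrier (sect (I q) U) \<longrightarrow>
         d q U (\<pi> U s) = \<zero>\<^bsub>sect (I (Suc q)) U\<^esub> \<and> (d q U s = \<zero>\<^bsub>sect (I (Suc q)) U\<^esub> \<longrightarrow> \<pi> U s = s))" for q \<pi>
  have step: "\<exists>\<pi>'. proj (Suc q) \<pi>' \<and>
      (\<forall>U s. openin X U \<and> s \<in> carrier (sect (I (Suc q)) U) \<longrightarrow> \<pi>' U s \<in> d q U ` carrier (sect (I q) U))"
    if \<pi>: "proj q \<pi>" for q \<pi>
  proof -
    from \<pi> have \<pi>1: "\<pi> \<in> sheaf_hom X \<O> (I q) (I q)"
      and \<pi>2: "\<And>U s. openin X U \<Longrightarrow> s \<in> carrier (sect (I q) U) \<Longrightarrow> d q U (\<pi> U s) = \<zero>\<^bsub>sect (I (Suc q)) U\<^esub>"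
      and \<pi>3: "\<And>U s. openin X U \<Longrightarrow> s \<in> carrier (sect (I q) U) \<Longrightarrow> d q U s = \<zero>\<^bsub>sect (I (Suc q)) U\<^esub> \<Longrightarrow> \<pi> U s = s"
      by (simp_all add: proj_def)
    show ?thesis
      by (rule kernel_projection_step[OF inj Is Is d d ex \<pi>1 \<pi>2 \<pi>3])
        (assumption | (simp add: proj_def; blast))+
  qed
  have ex_proj: "\<exists>\<pi>. proj q \<pi>" for q
  proof (induction q)
    case 0
    let ?z = "\<zero>\<^bsub>sect (hom_sheaf X \<O> (I 0) (I 0)) (topspace X)\<^esub>"
    have "?z \<in> sheaf_hom X \<O> (I 0) (I 0)"
      using abelian_groupE(2)[OF hom_sheaf_group[OF I' I', of "topspace X"]] by (simp add: hom_sheaf_simps(1))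
    moreover have "?z U s = \<zero>\<^bsub>sect (I 0) U\<^esub>" if "openin X U" "s \<in> carrier (sect (I 0) U)" for U s
      using that by (simp add: hom_sheaf_simps(2))
    ultimately have "proj 0 ?z"
      using inj0 additive_zero[OF presheaf_group[OF I'] presheaf_group[OF I'] sheaf_hom_additive[OF d]]
      by (auto simp: proj_def)
    then show ?case by blast
  next
    case (Suc q)
    then show ?case using step by blast
  qed
  show ?thesis
  proof (cases q)
    case 0
    have "d 0 U \<zero>\<^bsub>sect (I 0) U\<^esub> = \<zero>\<^bsub>sect (I 1) U\<^esub>"
      using additive_zero[OF presheaf_group[OF I' U] presheaf_group[OF I' U] sheaf_hom_additive[OF d U]]
      by simp
    then show ?thesis
      using 0 inj0[OF U] abelian_groupE(2)[OF presheaf_group[OF I' U]]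
      by (auto simp: cocycles_def coboundaries_def sheaf_kernel_def)
  next
    case (Suc p)
    obtain \<pi> where "proj p \<pi>" using ex_proj by blast
    from step[OF this] obtain \<pi>' where \<pi>': "proj (Suc p) \<pi>'"
      and im: "\<And>s. s \<in> carrier (sect (I (Suc p)) U) \<Longrightarrow> \<pi>' U s \<in> d p U ` carrier (sect (I p) U)"
      using U by blast
    have "cocycles I d q U \<subseteq> coboundaries I d q U"
    proof
      fix s assume "s \<in> cocycles I d q U"
      then have s: "s \<in> carrier (sect (I (Suc p)) U)" "d (Suc p) U s = \<zero>\<^bsub>sect (I (Suc (Suc p))) U\<^esub>"
        by (simp_all add: Suc cocycles_def sheaf_kernel_def)
      then have "\<pi>' U s = s" using \<pi>' U by (simp add: proj_def)
      then show "s \<in> coboundaries I d q U" using im[OF s(1)] by (simp add: Suc coboundaries_def)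
    qed
    moreover have "coboundaries I d q U \<subseteq> cocycles I d q U"
    proof
      fix s assume "s \<in> coboundaries I d q U"
      then obtain t where t: "t \<in> carrier (sect (I p) U)" and st: "s = d p U t"
        by (auto simp: Suc coboundaries_def)
      have s: "s \<in> carrier (sect (I (Suc p)) U)" unfolding st by (rule sheaf_hom_closed[OF d U t])
      have "s \<in> sheaf_image X (I p) (I (Suc p)) (d p) U"
        using section_image_in_sheaf_image[where F = "I p" and \<phi> = "d p", OF I' U t] s by (simp add: st)
      then show "s \<in> cocycles I d q U"
        using ex[of p] U by (simp add: exact_at_def cocycles_def Suc)
    qed
    ultimately show ?thesis by blast
  qed
qed

text \<open>
  The operations of \<^const>\<open>quot_module\<close> are set operations, so triviality includes that the only
  coset, \<open>B\<close> itself, is idempotent under addition of sets.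
\<close>

lemma quotient_by_itself_trivial:
  assumes M: "abelian_group M" and B: "subgroup B (add_monoid M)"
  shows "trivial_group (add_monoid (quot_module (M\<lparr>carrier := B\<rparr>) B))"
proof -
  interpret M: abelian_group M by (rule M)
  interpret B: subgroup B "add_monoid M" by (rule B)
  have "B +>\<^bsub>M\<lparr>carrier := B\<rparr>\<^esub> a = B" if "a \<in> B" for a
    using M.a_coset_join2[OF _ B that] B.subset that by (auto simp: a_r_coset_def r_coset_def)
  then have carr: "a_rcosets\<^bsub>M\<lparr>carrier := B\<rparr>\<^esub> B = {B}"
    using B.one_closed by (auto simp: A_RCOSETS_def')
  have add: "B <+>\<^bsub>M\<lparr>carrier := B\<rparr>\<^esub> B = B"
  proof
    show "B <+>\<^bsub>M\<lparr>carrier := B\<rparr>\<^esub> B \<subseteq> B" using B.m_closed by (auto simp: set_add_def')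
    show "B \<subseteq> B <+>\<^bsub>M\<lparr>carrier := B\<rparr>\<^esub> B"
    proof
      fix b assume b: "b \<in> B"
      then have "b = \<zero>\<^bsub>M\<^esub> \<oplus>\<^bsub>M\<^esub> b" using B.subset by auto
      then show "b \<in> B <+>\<^bsub>M\<lparr>carrier := B\<rparr>\<^esub> B" using b B.one_closed by (force simp: set_add_def')
    qed
  qed
  have "group (add_monoid (quot_module (M\<lparr>carrier := B\<rparr>) B))"
    by (rule groupI) (simp_all add: quot_module_def carr add)
  then show ?thesis by (simp add: trivial_group_def quot_module_def carr)
qed

lemma sheaf_cohomology_of_zero_trivial:
  assumes res: "injective_resolution X \<O> F J d \<epsilon>"
    and zero: "\<And>U s s'. openin X U \<Longrightarrow> s \<in> carrier (sect F U) \<Longrightarrow> s' \<in> carrier (sect F U) \<Longrightarrow> s = s'"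
  shows "trivial_group (add_monoid (sheaf_cohomology X J d q))"
proof -
  have J: "module_presheaf X \<O> (J q)" and d: "d q \<in> sheaf_hom X \<O> (J q) (J (Suc q))" for q
    using res by (simp_all add: injective_resolution_def injective_sheaf_def module_sheaf_def)
  have top: "openin X (topspace X)" by simp
  have "coboundaries J d q (topspace X) = cocycles J d q (topspace X)"
    using resolution_of_zero_exact_on_sections[OF res zero top] by simp
  moreover have "subgroup (cocycles J d q (topspace X)) (add_monoid (sect (J q) (topspace X)))"
    unfolding cocycles_def by (rule submodule.axioms(1)[OF sheaf_kernel_submodule[OF J J d top]])
  ultimately show ?thesis
    using quotient_by_itself_trivial[OF presheaf_group[OF J top]]
    by (simp add: sheaf_cohomology_def cohomology_presheaf_def)
qed

lemma trivial_sum_group: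
  assumes "\<And>i. i \<in> S \<Longrightarrow> trivial_group (G i)"
  shows "trivial_group (sum_group S G)"
proof -
  have G: "group (G i)" "carrier (G i) = {\<one>\<^bsub>G i\<^esub>}" if "i \<in> S" for i
    using assms[OF that] by (auto simp: trivial_group_def)
  then have "carrier (sum_group S G) \<subseteq> (\<Pi>\<^sub>E i\<in>S. {\<one>\<^bsub>G i\<^esub>})"
    by (force simp: carrier_sum_group PiE_iff)
  also have "\<dots> = {\<one>\<^bsub>sum_group S G\<^esub>}"
    by (simp add: PiE_eq_singleton)
  finally have "carrier (sum_group S G) \<subseteq> {\<one>\<^bsub>sum_group S G\<^esub>}" .
  moreover have "group (sum_group S G)" by (rule sum_group) (rule G(1))
  ultimately show ?thesis by (simp only: group.trivial_group_subset)
qed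

theorem proposition5:
  fixes X :: "'a topology" and A :: "'a chart set" and n k :: nat
    and E :: "('a, 'e) mod_sheaf" and G :: "('a, 'g) mod_sheaf"
    and I :: "nat \<Rightarrow> ('a, 'i) mod_sheaf" and J :: "nat \<Rightarrow> ('a, 'j) mod_sheaf"
  assumes "compact_kaehler_manifold n X A"
    and "locally_free_finite_rank X (structure_sheaf n A) E"
    and "coherent X (structure_sheaf n A) G"
    and "k > 0"
    and "injective_resolution X (structure_sheaf n A) G I dI \<epsilon>I"
    and "injective_resolution X (structure_sheaf n A)
           (sheaf_Ext X (structure_sheaf n A) E I dI k) J dJ \<epsilon>J"
  shows "trivial_group (vertex_operators X J dJ)"
proof -
  have "holomorphic_atlas n X A"
    using assms(1) by (simp add: compact_kaehler_manifold_def complex_manifold_def)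
  then have "restriction_presheaf X (structure_sheaf n A)"
    by (rule structure_sheaf_restriction_presheaf)
  note Ext_zero = sheaf_Ext_subsingleton[OF this assms(2,5,4)]
  show ?thesis
    unfolding vertex_operators_def
    by (rule trivial_sum_group)
      (rule sheaf_cohomology_of_zero_trivial[OF assms(6)], rule Ext_zero)
qed

end
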